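(* If $L$ is a non-scattered nonempty linear order, then $\mathrm{Val}_{\mathrm{LO}^{\mathrm{cond}}}(L,\mathcal L^{\Diamond}_{\le}(L))=\mathsf{S4.2.1}$. Consequently, the set of propositional modal formulas valid at every world $W$ of $\mathrm{LO}^{\mathrm{cond}}$ with respect to $\mathcal L^{\Diamond}_{\le}(W)$ is exactly $\mathsf{S4.2.1}$.
   Context: A linear order is scattered if it contains no copy of $(\mathbb Q,\le)$. A condensation is a surjective monotone map between nonempty linear orders; $\mathrm{LO}^{\mathrm{cond}}$ is the category of nonempty linear orders and condensations. $\mathcal L^{\Diamond}_{\le}(W)$ is the modal extension (operators $\Diamond,\Box$) of $\{\le\}$ with constants naming elements of $W$ (transported along morphisms). Modal satisfaction: $U\models\Diamond\varphi[\nu]$ iff there is a morphism $f:U\to V$ with $V\models\varphi[f\circ\nu]$; $\Box$ dually. $\mathrm{Val}(W,\Gamma)$ is the set of propositional modal formulas $\psi(p_0,\dots,p_n)$ all of whose substitution instances $\psi(\varphi_0,\dots,\varphi_n)$ with $\varphi_i\in\Gamma$ hold at $W$. $\mathsf{S4.2.1}$ is the normal modal logic axiomatized by $\Box p\to p$, $\Box p\to\Box\Box p$, $\Diamond\Box p\to\Box\Diamond p$, and $\Box\Diamond p\to\Diamond\Box p$. *)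

theory Defs
  imports Complex_Main
begin

text \<open>
  A linear order is represented by its (reflexive) order relation \<open>r\<close>; its carrier is \<open>Field r\<close>,
  an arbitrary subset of the type \<open>'a\<close>.
\<close>

definition lo :: "'a rel \<Rightarrow> bool" where
  "lo r \<longleftrightarrow> Linear_order r \<and> Field r \<noteq> {}"

definition condensation :: "'a rel \<Rightarrow> 'b rel \<Rightarrow> ('a \<Rightarrow> 'b) \<Rightarrow> bool" where
  "condensation r s f \<longleftrightarrow>
     (\<forall>x y. (x, y) \<in> r \<longrightarrow> (f x, f y) \<in> s) \<and> f ` Field r = Field s"

definition scattered :: "'a rel \<Rightarrow> bool" where
  "scattered r \<longleftrightarrow> \<not> (\<exists>e :: rat \<Rightarrow> 'a. \<forall>x y. x \<le> y \<longleftrightarrow> (e x, e y) \<in> r)"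


subsection \<open>The modal first-order language of orders\<close>

text \<open>\<open>'c\<close> is the type of names of constants.\<close>

datatype 'c trm = Var nat | Const 'c

datatype 'c fm =
    Eq "'c trm" "'c trm"
  | Le "'c trm" "'c trm"
  | Fls
  | Imp "'c fm" "'c fm"
  | All nat "'c fm"
  | Box "'c fm"

abbreviation Neg :: "'c fm \<Rightarrow> 'c fm" where "Neg \<phi> \<equiv> Imp \<phi> Fls"
abbreviation Ex :: "nat \<Rightarrow> 'c fm \<Rightarrow> 'c fm" where "Ex n \<phi> \<equiv> Neg (All n (Neg \<phi>))"
abbreviation Dia :: "'c fm \<Rightarrow> 'c fm" where "Dia \<phi> \<equiv> Neg (Box (Neg \<phi>))"

fun tfv :: "'c trm \<Rightarrow> nat set" where
  "tfv (Var n) = {n}"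
| "tfv (Const c) = {}"

fun fv :: "'c fm \<Rightarrow> nat set" where
  "fv (Eq s t) = tfv s \<union> tfv t"
| "fv (Le s t) = tfv s \<union> tfv t"
| "fv Fls = {}"
| "fv (Imp \<phi> \<psi>) = fv \<phi> \<union> fv \<psi>"
| "fv (All n \<phi>) = fv \<phi> - {n}"
| "fv (Box \<phi>) = fv \<phi>"

fun tval :: "('c \<Rightarrow> 'a) \<Rightarrow> (nat \<Rightarrow> 'a) \<Rightarrow> 'c trm \<Rightarrow> 'a" where
  "tval \<iota> \<nu> (Var n) = \<nu> n"
| "tval \<iota> \<nu> (Const c) = \<iota> c"

text \<open>
  \<open>\<iota>\<close> interprets the constants in the current world and \<open>\<nu>\<close> the variables; both are transported
  along morphisms. In the modal clause the target \<open>V\<close> ranges over orders on subsets of the same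
  type as \<open>U\<close>. Since condensations are surjective, every condensation out of \<open>U\<close> is, up to
  isomorphism, one onto an order on a subset of \<open>Field U\<close>, so nothing is lost; the lemmas
  \<open>sat_Box_any\<close> and \<open>sat_Dia_any\<close> below give the modal clauses for targets of arbitrary type.
\<close>

primrec sat :: "'a rel \<Rightarrow> ('c \<Rightarrow> 'a) \<Rightarrow> (nat \<Rightarrow> 'a) \<Rightarrow> 'c fm \<Rightarrow> bool" where
  "sat U \<iota> \<nu> (Eq s t) \<longleftrightarrow> tval \<iota> \<nu> s = tval \<iota> \<nu> t"
| "sat U \<iota> \<nu> (Le s t) \<longleftrightarrow> (tval \<iota> \<nu> s, tval \<iota> \<nu> t) \<in> U"
| "sat U \<iota> \<nu> Fls \<longleftrightarrow> False"
| "sat U \<iota> \<nu> (Imp \<phi> \<psi>) \<longleftrightarrow> (sat U \<iota> \<nu> \<phi> \<longrightarrow> sat U \<iota> \<nu> \<psi>)"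
| "sat U \<iota> \<nu> (All n \<phi>) \<longleftrightarrow> (\<forall>x\<in>Field U. sat U \<iota> (\<nu>(n := x)) \<phi>)"
| "sat U \<iota> \<nu> (Box \<phi>) \<longleftrightarrow>
     (\<forall>V f. lo V \<and> condensation U V f \<longrightarrow> sat V (f \<circ> \<iota>) (f \<circ> \<nu>) \<phi>)"

lemma sat_Dia:
  fixes U :: "'a rel"
  shows "sat U \<iota> \<nu> (Dia \<phi>) \<longleftrightarrow>
     (\<exists>(V :: 'a rel) f. lo V \<and> condensation U V f \<and> sat V (f \<circ> \<iota>) (f \<circ> \<nu>) \<phi>)"
  by auto

lemma sat_Ex: "sat U \<iota> \<nu> (Ex n \<phi>) \<longleftrightarrow> (\<exists>x\<in>Field U. sat U \<iota> (\<nu>(n := x)) \<phi>)"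
  by auto

text \<open>The sentences with parameters from the world \<open>W\<close>, elements serving as their own names.\<close>

definition lang :: "'a rel \<Rightarrow> 'a fm set" where
  "lang W = {\<phi>. fv \<phi> = {} \<and> set_fm \<phi> \<subseteq> Field W}"

definition holds :: "'a rel \<Rightarrow> 'a fm \<Rightarrow> bool" where
  "holds W \<phi> \<longleftrightarrow> (\<forall>\<nu>. range \<nu> \<subseteq> Field W \<longrightarrow> sat W id \<nu> \<phi>)"


subsection \<open>Propositional modal logic\<close>

datatype pfm =
    PVar nat
  | PFls
  | PImp pfm pfm  (infixr "\<rightarrow>\<^sub>p" 55)
  | PBox pfm  ("\<box>\<^sub>p _" [60] 60)

abbreviation PNeg :: "pfm \<Rightarrow> pfm"  ("\<not>\<^sub>p _" [60] 60) where "\<not>\<^sub>p \<phi> \<equiv> \<phi> \<rightarrow>\<^sub>p PFls"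
abbreviation PDia :: "pfm \<Rightarrow> pfm"  ("\<diamond>\<^sub>p _" [60] 60) where "\<diamond>\<^sub>p \<phi> \<equiv> \<not>\<^sub>p \<box>\<^sub>p \<not>\<^sub>p \<phi>"

fun psubst :: "(nat \<Rightarrow> pfm) \<Rightarrow> pfm \<Rightarrow> pfm" where
  "psubst \<sigma> (PVar n) = \<sigma> n"
| "psubst \<sigma> PFls = PFls"
| "psubst \<sigma> (\<phi> \<rightarrow>\<^sub>p \<psi>) = psubst \<sigma> \<phi> \<rightarrow>\<^sub>p psubst \<sigma> \<psi>"
| "psubst \<sigma> (\<box>\<^sub>p \<phi>) = \<box>\<^sub>p psubst \<sigma> \<phi>"

text \<open>Classical evaluation; variables and boxed formulas count as atoms.\<close>

fun peval :: "(pfm \<Rightarrow> bool) \<Rightarrow> pfm \<Rightarrow> bool" where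
  "peval v (PVar n) = v (PVar n)"
| "peval v PFls = False"
| "peval v (\<phi> \<rightarrow>\<^sub>p \<psi>) = (peval v \<phi> \<longrightarrow> peval v \<psi>)"
| "peval v (\<box>\<^sub>p \<phi>) = v (\<box>\<^sub>p \<phi>)"

definition tautology :: "pfm \<Rightarrow> bool" where
  "tautology \<phi> \<longleftrightarrow> (\<forall>v. peval v \<phi>)"

inductive_set normal_logic :: "pfm set \<Rightarrow> pfm set" for A where
  taut: "tautology \<phi> \<Longrightarrow> \<phi> \<in> normal_logic A"
| K: "\<box>\<^sub>p (\<phi> \<rightarrow>\<^sub>p \<psi>) \<rightarrow>\<^sub>p \<box>\<^sub>p \<phi> \<rightarrow>\<^sub>p \<box>\<^sub>p \<psi> \<in> normal_logic A"
| ax: "\<phi> \<in> A \<Longrightarrow> \<phi> \<in> normal_logic A"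
| MP: "\<phi> \<rightarrow>\<^sub>p \<psi> \<in> normal_logic A \<Longrightarrow> \<phi> \<in> normal_logic A \<Longrightarrow> \<psi> \<in> normal_logic A"
| Nec: "\<phi> \<in> normal_logic A \<Longrightarrow> \<box>\<^sub>p \<phi> \<in> normal_logic A"
| Sub: "\<phi> \<in> normal_logic A \<Longrightarrow> psubst \<sigma> \<phi> \<in> normal_logic A"

definition S421 :: "pfm set" where
  "S421 = (let p = PVar 0 in normal_logic
     {\<box>\<^sub>p p \<rightarrow>\<^sub>p p,
      \<box>\<^sub>p p \<rightarrow>\<^sub>p \<box>\<^sub>p \<box>\<^sub>p p,
      \<diamond>\<^sub>p \<box>\<^sub>p p \<rightarrow>\<^sub>p \<box>\<^sub>p \<diamond>\<^sub>p p,
      \<box>\<^sub>p \<diamond>\<^sub>p p \<rightarrow>\<^sub>p \<diamond>\<^sub>p \<box>\<^sub>p p})"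


subsection \<open>Validities\<close>

fun inst :: "(nat \<Rightarrow> 'c fm) \<Rightarrow> pfm \<Rightarrow> 'c fm" where
  "inst \<sigma> (PVar n) = \<sigma> n"
| "inst \<sigma> PFls = Fls"
| "inst \<sigma> (\<phi> \<rightarrow>\<^sub>p \<psi>) = Imp (inst \<sigma> \<phi>) (inst \<sigma> \<psi>)"
| "inst \<sigma> (\<box>\<^sub>p \<phi>) = Box (inst \<sigma> \<phi>)"

definition Val :: "'a rel \<Rightarrow> 'a fm set \<Rightarrow> pfm set" where
  "Val W \<Gamma> = {\<psi>. \<forall>\<sigma>. range \<sigma> \<subseteq> \<Gamma> \<longrightarrow> holds W (inst \<sigma> \<psi>)}"


subsection \<open>Targets of arbitrary type\<close>

definition oiso :: "'a rel \<Rightarrow> 'b rel \<Rightarrow> ('a \<Rightarrow> 'b) \<Rightarrow> bool" where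
  "oiso r s h \<longleftrightarrow> bij_betw h (Field r) (Field s) \<and>
     (\<forall>x\<in>Field r. \<forall>y\<in>Field r. (x, y) \<in> r \<longleftrightarrow> (h x, h y) \<in> s)"

lemma oiso_inv:
  assumes "oiso r s h"
  shows "oiso s r (inv_into (Field r) h)"
proof -
  let ?g = "inv_into (Field r) h"
  have b: "bij_betw h (Field r) (Field s)" using assms by (simp add: oiso_def)
  have bg: "bij_betw ?g (Field s) (Field r)" using b by (rule bij_betw_inv_into)
  have "(x, y) \<in> s \<longleftrightarrow> (?g x, ?g y) \<in> r" if "x \<in> Field s" "y \<in> Field s" for x y
  proof -
    have "?g x \<in> Field r" "?g y \<in> Field r" using bg that by (auto dest: bij_betwE)
    moreover have "h (?g x) = x" "h (?g y) = y"
      using b that by (simp_all add: bij_betw_inv_into_right)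
    ultimately show ?thesis using assms by (metis oiso_def)
  qed
  then show ?thesis using bg by (simp add: oiso_def)
qed

lemma lo_transfer:
  assumes "lo r" and inj: "inj_on k (Field r)"
  defines "s \<equiv> (\<lambda>(x, y). (k x, k y)) ` r"
  shows "lo s" "oiso r s k" "Field s = k ` Field r"
proof -
  have lin: "Linear_order r" and ne: "Field r \<noteq> {}" using assms(1) by (auto simp: lo_def)
  show F: "Field s = k ` Field r" by (force simp: s_def Field_def)
  have iff: "(k x, k y) \<in> s \<longleftrightarrow> (x, y) \<in> r" if "x \<in> Field r" "y \<in> Field r" for x y
  proof
    assume "(k x, k y) \<in> s"
    then obtain x' y' where "(x', y') \<in> r" "k x = k x'" "k y = k y'" by (auto simp: s_def)
    moreover from this have "x' \<in> Field r" "y' \<in> Field r" by (auto simp: Field_def)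
    ultimately show "(x, y) \<in> r" using inj that by (metis inj_onD)
  qed (force simp: s_def)
  show "oiso r s k" using inj F iff by (simp add: oiso_def bij_betw_def)
  have r: "(x, x) \<in> r" if "x \<in> Field r" for x
    using lin that by (auto simp: order_on_defs refl_on_def)
  have t: "(x, z) \<in> r" if "(x, y) \<in> r" "(y, z) \<in> r" for x y z
    using lin that by (meson order_on_defs transD)
  have a: "x = y" if "(x, y) \<in> r" "(y, x) \<in> r" for x y
    using lin that by (meson order_on_defs antisymD)
  have l: "(x, y) \<in> r \<or> (y, x) \<in> r" if "x \<in> Field r" "y \<in> Field r" for x y
    using lin that r by (metis order_on_defs(3) total_on_def)
  have "refl_on (Field s) s" using F iff r by (auto simp: refl_on_def)
  moreover have "s \<subseteq> Field s \<times> Field s" by (auto simp: Field_def)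
  moreover have "trans s"
  proof (rule transI)
    fix u v w assume h: "(u, v) \<in> s" "(v, w) \<in> s"
    then have "u \<in> Field s" "v \<in> Field s" "w \<in> Field s" by (auto simp: Field_def)
    then show "(u, w) \<in> s" using h F iff t by (smt (verit) imageE)
  qed
  moreover have "antisym s"
  proof (rule antisymI)
    fix u v assume h: "(u, v) \<in> s" "(v, u) \<in> s"
    then have "u \<in> Field s" "v \<in> Field s" by (auto simp: Field_def)
    then show "u = v" using h F iff a by (smt (verit) imageE)
  qed
  moreover have "total_on (Field s) s" using F iff l by (auto simp: total_on_def)
  ultimately show "lo s" using F ne by (simp add: lo_def order_on_defs)
qed

text \<open>
  Any condensation \<open>f : r \<rightarrow> v\<close>, of whatever type, is reproduced on the other side of an
  isomorphism \<open>h : r \<rightarrow> r'\<close> by a condensation between orders on the type of \<open>r'\<close>.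
\<close>

lemma condensation_transfer:
  fixes r :: "'a rel" and r' :: "'b rel" and v :: "'d rel"
  assumes r': "lo r'" and h: "oiso r r' h" and v: "lo v" and f: "condensation r v f"
  obtains v' :: "'b rel" and f' :: "'b \<Rightarrow> 'b" and k :: "'d \<Rightarrow> 'b"
  where "lo v'" "condensation r' v' f'" "oiso v v' k" "\<forall>x\<in>Field r. f' (h x) = k (f x)"
proof -
  define k where "k = h \<circ> inv_into (Field r) f"
  define g where "g = inv_into (Field r) h"
  define f' where "f' = k \<circ> f \<circ> g"
  define v' where "v' = (\<lambda>(x, y). (k x, k y)) ` v"
  have b: "bij_betw h (Field r) (Field r')" using h by (simp add: oiso_def)
  have fF: "f ` Field r = Field v" using f by (simp add: condensation_def)
  have "inj_on (inv_into (Field r) f) (Field v)" by (metis fF inj_on_inv_into subset_refl)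
  moreover have "inv_into (Field r) f ` Field v \<subseteq> Field r"
    using fF by (auto intro: inv_into_into)
  ultimately have inj: "inj_on k (Field v)"
    unfolding k_def using b by (meson bij_betw_def comp_inj_on inj_on_subset)
  note T = lo_transfer[OF v inj, folded v'_def]
  have gi: "oiso r' r g" unfolding g_def using h by (rule oiso_inv)
  have gF: "g ` Field r' = Field r" using gi by (simp add: oiso_def bij_betw_def)
  have eq: "\<forall>x\<in>Field r. f' (h x) = k (f x)"
    using b by (simp add: f'_def g_def bij_betw_inv_into_left)
  have "(f' x, f' y) \<in> v'" if xy: "(x, y) \<in> r'" for x y
  proof -
    have "x \<in> Field r'" "y \<in> Field r'" using xy by (auto simp: Field_def)
    then have "(g x, g y) \<in> r" using gi xy by (simp add: oiso_def)
    then have "(f (g x), f (g y)) \<in> v" using f by (simp add: condensation_def)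
    then show ?thesis by (force simp: f'_def v'_def)
  qed
  moreover have "f' ` Field r' = Field v'"
    unfolding f'_def image_comp[symmetric] gF fF T(3) ..
  ultimately have "condensation r' v' f'" by (simp add: condensation_def)
  with T eq show thesis using that by blast
qed

lemma tval_cong:
  assumes "\<forall>c\<in>set_trm t. \<iota> c = \<iota>' c" "\<forall>n\<in>tfv t. \<nu> n = \<nu>' n"
  shows "tval \<iota> \<nu> t = tval \<iota>' \<nu>' t"
  using assms by (cases t) auto

lemma sat_cong:
  fixes U :: "'a rel"
  assumes "\<forall>c\<in>set_fm \<phi>. \<iota> c = \<iota>' c" "\<forall>n\<in>fv \<phi>. \<nu> n = \<nu>' n"
  shows "sat U \<iota> \<nu> \<phi> \<longleftrightarrow> sat U \<iota>' \<nu>' \<phi>"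
  using assms
proof (induction \<phi> arbitrary: U \<iota> \<iota>' \<nu> \<nu>')
  case (Eq s t)
  have "tval \<iota> \<nu> s = tval \<iota>' \<nu>' s" "tval \<iota> \<nu> t = tval \<iota>' \<nu>' t"
    by (rule tval_cong; use Eq in simp)+
  then show ?case by simp
next
  case (Le s t)
  have "tval \<iota> \<nu> s = tval \<iota>' \<nu>' s" "tval \<iota> \<nu> t = tval \<iota>' \<nu>' t"
    by (rule tval_cong; use Le in simp)+
  then show ?case by simp
next
  case Fls
  then show ?case by simp
next
  case (Imp \<phi> \<psi>)
  have "sat U \<iota> \<nu> \<phi> \<longleftrightarrow> sat U \<iota>' \<nu>' \<phi>" "sat U \<iota> \<nu> \<psi> \<longleftrightarrow> sat U \<iota>' \<nu>' \<psi>"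
    by (rule Imp.IH; use Imp.prems in simp)+
  then show ?case by simp
next
  case (All n \<phi>)
  have "sat U \<iota> (\<nu>(n := x)) \<phi> \<longleftrightarrow> sat U \<iota>' (\<nu>'(n := x)) \<phi>" for x
    by (rule All.IH) (use All.prems in auto)
  then show ?case by simp
next
  case (Box \<phi>)
  have "sat V (f \<circ> \<iota>) (f \<circ> \<nu>) \<phi> \<longleftrightarrow> sat V (f \<circ> \<iota>') (f \<circ> \<nu>') \<phi>" for V :: "'a rel" and f
    by (rule Box.IH) (use Box.prems in auto)
  then show ?case by simp
qed

lemma tval_oiso:
  assumes "\<forall>c\<in>set_trm t. \<iota> c \<in> Field U" "\<forall>n\<in>tfv t. \<nu> n \<in> Field U"
  shows "tval (h \<circ> \<iota>) (h \<circ> \<nu>) t = h (tval \<iota> \<nu> t)" "tval \<iota> \<nu> t \<in> Field U"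
  using assms by (cases t; auto)+

lemma sat_oiso:
  fixes U :: "'a rel" and U' :: "'b rel"
  assumes "lo U" "lo U'" "oiso U U' h"
    and "\<forall>c\<in>set_fm \<phi>. \<iota> c \<in> Field U" "\<forall>n\<in>fv \<phi>. \<nu> n \<in> Field U"
  shows "sat U \<iota> \<nu> \<phi> \<longleftrightarrow> sat U' (h \<circ> \<iota>) (h \<circ> \<nu>) \<phi>"
  using assms
proof (induction \<phi> arbitrary: U U' h \<iota> \<nu>)
  case (Eq s t)
  have s: "\<forall>c\<in>set_trm s. \<iota> c \<in> Field U" "\<forall>n\<in>tfv s. \<nu> n \<in> Field U"
    and t: "\<forall>c\<in>set_trm t. \<iota> c \<in> Field U" "\<forall>n\<in>tfv t. \<nu> n \<in> Field U"
    using Eq by auto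
  have "inj_on h (Field U)" using Eq by (simp add: oiso_def bij_betw_def)
  then show ?case using tval_oiso(1)[OF s, of h] tval_oiso(1)[OF t, of h]
      tval_oiso(2)[OF s] tval_oiso(2)[OF t]
    by (simp add: inj_on_eq_iff comp_def)
next
  case (Le s t)
  have s: "\<forall>c\<in>set_trm s. \<iota> c \<in> Field U" "\<forall>n\<in>tfv s. \<nu> n \<in> Field U"
    and t: "\<forall>c\<in>set_trm t. \<iota> c \<in> Field U" "\<forall>n\<in>tfv t. \<nu> n \<in> Field U"
    using Le by auto
  then show ?case using tval_oiso(1)[OF s, of h] tval_oiso(1)[OF t, of h]
      tval_oiso(2)[OF s] tval_oiso(2)[OF t] Le.prems(3)
    by (simp add: oiso_def comp_def)
next
  case Fls
  then show ?case by simp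
next
  case (Imp \<phi> \<psi>)
  have "sat U \<iota> \<nu> \<phi> \<longleftrightarrow> sat U' (h \<circ> \<iota>) (h \<circ> \<nu>) \<phi>"
    by (rule Imp.IH(1)) (use Imp.prems in auto)
  moreover have "sat U \<iota> \<nu> \<psi> \<longleftrightarrow> sat U' (h \<circ> \<iota>) (h \<circ> \<nu>) \<psi>"
    by (rule Imp.IH(2)) (use Imp.prems in auto)
  ultimately show ?case by (simp add: comp_def)
next
  case (All n \<phi>)
  have "sat U \<iota> (\<nu>(n := x)) \<phi> \<longleftrightarrow> sat U' (h \<circ> \<iota>) ((h \<circ> \<nu>)(n := h x)) \<phi>"
    if "x \<in> Field U" for x
  proof -
    have "sat U \<iota> (\<nu>(n := x)) \<phi> \<longleftrightarrow> sat U' (h \<circ> \<iota>) (h \<circ> (\<nu>(n := x))) \<phi>"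
      by (rule All.IH) (use All.prems that in auto)
    then show ?thesis by (simp add: fun_upd_comp)
  qed
  moreover have "Field U' = h ` Field U" using All.prems by (simp add: oiso_def bij_betw_def)
  ultimately show ?case by (simp add: comp_def)
next
  case (Box \<phi>)
  let ?g = "inv_into (Field U) h"
  have b: "bij_betw h (Field U) (Field U')" using Box.prems by (simp add: oiso_def)
  have c: "\<forall>c\<in>set_fm \<phi>. \<iota> c \<in> Field U" and n: "\<forall>n\<in>fv \<phi>. \<nu> n \<in> Field U"
    using Box.prems by auto
  have step: "sat V (f \<circ> \<iota>) (f \<circ> \<nu>) \<phi> \<longleftrightarrow> sat V' (f' \<circ> (h \<circ> \<iota>)) (f' \<circ> (h \<circ> \<nu>)) \<phi>"
    if V: "lo V" "condensation U V f" "lo V'" "oiso V V' k"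
      and eq: "\<forall>x\<in>Field U. f' (h x) = k (f x)"
    for V :: "'a rel" and V' :: "'b rel" and f f' k
  proof -
    have fF: "f ` Field U = Field V" using V by (simp add: condensation_def)
    have "sat V (f \<circ> \<iota>) (f \<circ> \<nu>) \<phi> \<longleftrightarrow> sat V' (k \<circ> (f \<circ> \<iota>)) (k \<circ> (f \<circ> \<nu>)) \<phi>"
      by (rule Box.IH) (use V c n fF in auto)
    also have "\<dots> \<longleftrightarrow> sat V' (f' \<circ> (h \<circ> \<iota>)) (f' \<circ> (h \<circ> \<nu>)) \<phi>"
      by (rule sat_cong) (use eq c n in auto)
    finally show ?thesis .
  qed
  show ?case
  proof
    assume L: "sat U \<iota> \<nu> (Box \<phi>)"
    have "sat V' (f' \<circ> (h \<circ> \<iota>)) (f' \<circ> (h \<circ> \<nu>)) \<phi>"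
      if V': "lo V'" "condensation U' V' f'" for V' :: "'b rel" and f'
    proof -
      obtain V :: "'a rel" and f k where
        V: "lo V" "condensation U V f" "oiso V' V k" "\<forall>x\<in>Field U'. f (?g x) = k (f' x)"
        using condensation_transfer[OF Box.prems(1) oiso_inv[OF Box.prems(3)] V'] by blast
      let ?k = "inv_into (Field V') k"
      have "\<forall>x\<in>Field U. f' (h x) = ?k (f x)"
      proof
        fix x assume x: "x \<in> Field U"
        then have hx: "h x \<in> Field U'" using b by (auto dest: bij_betwE)
        then have "f x = k (f' (h x))"
          using V(4) x b by (metis bij_betw_inv_into_left)
        moreover have "f' (h x) \<in> Field V'" using hx V' by (auto simp: condensation_def)
        moreover have "bij_betw k (Field V') (Field V)" using V by (simp add: oiso_def)
        ultimately show "f' (h x) = ?k (f x)" by (simp add: bij_betw_inv_into_left)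
      qed
      from step[OF V(1,2) V'(1) oiso_inv[OF V(3)] this] show ?thesis using L V by (simp add: comp_def)
    qed
    then show "sat U' (h \<circ> \<iota>) (h \<circ> \<nu>) (Box \<phi>)" by (simp add: comp_def)
  next
    assume R: "sat U' (h \<circ> \<iota>) (h \<circ> \<nu>) (Box \<phi>)"
    have "sat V (f \<circ> \<iota>) (f \<circ> \<nu>) \<phi>" if V: "lo V" "condensation U V f" for V :: "'a rel" and f
    proof -
      obtain V' :: "'b rel" and f' k where
        V': "lo V'" "condensation U' V' f'" "oiso V V' k" "\<forall>x\<in>Field U. f' (h x) = k (f x)"
        using condensation_transfer[OF Box.prems(2,3) V] by blast
      from step[OF V V'(1,3,4)] show ?thesis using R V' by (simp add: comp_def)
    qed
    then show "sat U \<iota> \<nu> (Box \<phi>)" by (simp add: comp_def)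
  qed
qed

lemma sat_Box_any:
  fixes U :: "'a rel" and V :: "'b rel"
  assumes U: "lo U" and i: "\<forall>c\<in>set_fm \<phi>. \<iota> c \<in> Field U" "\<forall>n\<in>fv \<phi>. \<nu> n \<in> Field U"
    and box: "sat U \<iota> \<nu> (Box \<phi>)"
    and V: "lo V" "condensation U V f"
  shows "sat V (f \<circ> \<iota>) (f \<circ> \<nu>) \<phi>"
proof -
  have "oiso U U id" by (simp add: oiso_def)
  from condensation_transfer[OF U this V] obtain V' :: "'a rel" and f' k where
    V': "lo V'" "condensation U V' f'" "oiso V V' k" "\<forall>x\<in>Field U. f' x = k (f x)"
    by auto
  have fF: "f ` Field U = Field V" using V by (simp add: condensation_def)
  have "sat V (f \<circ> \<iota>) (f \<circ> \<nu>) \<phi> \<longleftrightarrow> sat V' (k \<circ> (f \<circ> \<iota>)) (k \<circ> (f \<circ> \<nu>)) \<phi>"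
    by (rule sat_oiso) (use V V' i fF in auto)
  also have "\<dots> \<longleftrightarrow> sat V' (f' \<circ> \<iota>) (f' \<circ> \<nu>) \<phi>"
    by (rule sat_cong) (use V' i in auto)
  finally show ?thesis using box V' by (simp add: comp_def)
qed

lemma sat_Dia_any:
  fixes U :: "'a rel" and V :: "'b rel"
  assumes U: "lo U" and i: "\<forall>c\<in>set_fm \<phi>. \<iota> c \<in> Field U" "\<forall>n\<in>fv \<phi>. \<nu> n \<in> Field U"
    and V: "lo V" "condensation U V f" "sat V (f \<circ> \<iota>) (f \<circ> \<nu>) \<phi>"
  shows "sat U \<iota> \<nu> (Dia \<phi>)"
  using sat_Box_any[OF U, of "Neg \<phi>" \<iota> \<nu> V f] i V by (auto simp: comp_def)

end

theory Submission
  imports Defs "HOL-Library.Countable"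
begin

text \<open>
  Soundness: every order condenses onto the one-point order, which has no proper condensations.

  Completeness: a non-theorem of S4.2.1 fails in a finite preorder with a single final point.
  Given such a frame with \<open>N\<close> points and a non-scattered \<open>L\<close>, choose \<open>a\<^sub>0 < \<dots> < a\<^sub>N\<close> in a copy
  of the rationals in \<open>L\<close>. The equations \<open>a\<^sub>i = a\<^sub>i\<^sub>+\<^sub>1\<close> are independent buttons, one for each point
  of the frame; the number of successive covers above \<open>a\<^sub>N\<close> is a dial which can be reset at will as
  long as the part above \<open>a\<^sub>N\<close> is non-scattered, which the modal language expresses as being possibly
  dense. The greatest pressed button determines a cluster and the dial a point in it; if the pressed
  buttons are not a chain, or the dial is broken, the point is the final one. This maps the
  condensations of \<open>L\<close> onto the frame by an expressible bounded morphism, so the countermodel is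
  reproduced at \<open>L\<close>.
\<close>

subsection \<open>Maximal consistent theories\<close>

definition classical_theory :: "pfm set \<Rightarrow> bool" where
  "classical_theory \<Gamma> \<longleftrightarrow>
     {\<phi>. tautology \<phi>} \<subseteq> \<Gamma> \<and> (\<forall>\<phi> \<psi>. \<phi> \<rightarrow>\<^sub>p \<psi> \<in> \<Gamma> \<longrightarrow> \<phi> \<in> \<Gamma> \<longrightarrow> \<psi> \<in> \<Gamma>)"

definition maximal_consistent :: "pfm set \<Rightarrow> bool" where
  "maximal_consistent w \<longleftrightarrow> classical_theory w \<and> PFls \<notin> w \<and> (\<forall>\<phi>. \<phi> \<in> w \<or> \<not>\<^sub>p \<phi> \<in> w)"

lemma classical_theory_tautology: "classical_theory \<Gamma> \<Longrightarrow> tautology \<phi> \<Longrightarrow> \<phi> \<in> \<Gamma>"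
  by (auto simp: classical_theory_def)

lemma classical_theory_MP: "classical_theory \<Gamma> \<Longrightarrow> \<phi> \<rightarrow>\<^sub>p \<psi> \<in> \<Gamma> \<Longrightarrow> \<phi> \<in> \<Gamma> \<Longrightarrow> \<psi> \<in> \<Gamma>"
  by (auto simp: classical_theory_def)

lemma classical_theory_consequence:
  assumes \<Gamma>: "classical_theory \<Gamma>" and "\<phi> \<in> \<Gamma>" "\<psi> \<in> \<Gamma>"
    and "\<And>v. peval v \<phi> \<Longrightarrow> peval v \<psi> \<Longrightarrow> peval v \<chi>"
  shows "\<chi> \<in> \<Gamma>"
proof -
  have "\<phi> \<rightarrow>\<^sub>p \<psi> \<rightarrow>\<^sub>p \<chi> \<in> \<Gamma>"
    using assms(4) by (intro classical_theory_tautology[OF \<Gamma>]) (simp add: tautology_def)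
  then show ?thesis
    using assms(2,3) classical_theory_MP[OF \<Gamma>] by blast
qed

lemma classical_theory_implied:
  assumes "classical_theory \<Gamma>"
  shows "classical_theory {\<theta>. \<chi> \<rightarrow>\<^sub>p \<theta> \<in> \<Gamma>}" and "insert \<chi> \<Gamma> \<subseteq> {\<theta>. \<chi> \<rightarrow>\<^sub>p \<theta> \<in> \<Gamma>}"
proof -
  have "\<chi> \<rightarrow>\<^sub>p \<psi> \<in> \<Gamma>" if "\<chi> \<rightarrow>\<^sub>p \<phi> \<rightarrow>\<^sub>p \<psi> \<in> \<Gamma>" "\<chi> \<rightarrow>\<^sub>p \<phi> \<in> \<Gamma>" for \<phi> \<psi>
    using assms that by (rule classical_theory_consequence) auto
  moreover have "\<chi> \<rightarrow>\<^sub>p \<phi> \<in> \<Gamma>" if "tautology \<phi>" for \<phi>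
    using that by (intro classical_theory_tautology[OF assms]) (simp add: tautology_def)
  ultimately show "classical_theory {\<theta>. \<chi> \<rightarrow>\<^sub>p \<theta> \<in> \<Gamma>}"
    by (auto simp: classical_theory_def)
  have "\<chi> \<rightarrow>\<^sub>p \<theta> \<in> \<Gamma>" if "\<theta> \<in> \<Gamma>" for \<theta>
    using assms that that by (rule classical_theory_consequence) auto
  moreover have "\<chi> \<rightarrow>\<^sub>p \<chi> \<in> \<Gamma>"
    by (intro classical_theory_tautology[OF assms]) (simp add: tautology_def)
  ultimately show "insert \<chi> \<Gamma> \<subseteq> {\<theta>. \<chi> \<rightarrow>\<^sub>p \<theta> \<in> \<Gamma>}"
    by auto
qed

lemma classical_theory_Union_chain:
  assumes chain: "subset.chain {\<Delta>. classical_theory \<Delta>} C" and "C \<noteq> {}"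
  shows "classical_theory (\<Union>C)"
proof -
  have theories: "\<And>X. X \<in> C \<Longrightarrow> classical_theory X"
    and linear: "\<And>X Y. X \<in> C \<Longrightarrow> Y \<in> C \<Longrightarrow> X \<subseteq> Y \<or> Y \<subseteq> X"
    using chain by (auto simp: subset_chain_def)
  have "\<psi> \<in> \<Union>C" if prems: "\<phi> \<rightarrow>\<^sub>p \<psi> \<in> \<Union>C" "\<phi> \<in> \<Union>C" for \<phi> \<psi>
  proof -
    obtain X Y where "X \<in> C" "Y \<in> C" "\<phi> \<rightarrow>\<^sub>p \<psi> \<in> X" "\<phi> \<in> Y"
      using prems by blast
    then obtain Z where "Z \<in> C" "\<phi> \<rightarrow>\<^sub>p \<psi> \<in> Z" "\<phi> \<in> Z"
      using linear by blast
    then show ?thesis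
      using classical_theory_MP theories by blast
  qed
  moreover have "{\<phi>. tautology \<phi>} \<subseteq> \<Union>C"
    using \<open>C \<noteq> {}\<close> theories by (auto simp: classical_theory_def)
  ultimately show ?thesis
    unfolding classical_theory_def by blast
qed

lemma maximal_consistent_if_maximal_omitting:
  assumes w: "classical_theory w" and "\<phi> \<notin> w"
    and maximal: "\<And>\<Delta>. classical_theory \<Delta> \<Longrightarrow> w \<subseteq> \<Delta> \<Longrightarrow> \<phi> \<notin> \<Delta> \<Longrightarrow> \<Delta> = w"
  shows "maximal_consistent w"
proof -
  have implied: "\<chi> \<rightarrow>\<^sub>p \<phi> \<in> w" if "\<chi> \<notin> w" for \<chi>
    using maximal[of "{\<theta>. \<chi> \<rightarrow>\<^sub>p \<theta> \<in> w}"] classical_theory_implied[OF w, of \<chi>] that by blast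
  have "PFls \<notin> w"
    using \<open>\<phi> \<notin> w\<close> classical_theory_consequence[OF w, of PFls PFls \<phi>] by auto
  moreover have "\<chi> \<in> w \<or> \<not>\<^sub>p \<chi> \<in> w" for \<chi>
  proof (rule ccontr)
    assume "\<not> (\<chi> \<in> w \<or> \<not>\<^sub>p \<chi> \<in> w)"
    then have "\<chi> \<rightarrow>\<^sub>p \<phi> \<in> w" "\<not>\<^sub>p \<chi> \<rightarrow>\<^sub>p \<phi> \<in> w"
      using implied by auto
    then have "\<phi> \<in> w"
      by (rule classical_theory_consequence[OF w]) auto
    then show False
      using \<open>\<phi> \<notin> w\<close> by simp
  qed
  ultimately show ?thesis
    using w by (simp add: maximal_consistent_def)
qed

lemma Lindenbaum:
  assumes "classical_theory \<Gamma>" "\<phi> \<notin> \<Gamma>"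
  obtains w where "maximal_consistent w" "\<Gamma> \<subseteq> w" "\<phi> \<notin> w"
proof -
  let ?A = "{\<Delta>. classical_theory \<Delta> \<and> \<Gamma> \<subseteq> \<Delta> \<and> \<phi> \<notin> \<Delta>}"
  have "\<Union>C \<in> ?A" if "C \<noteq> {}" "subset.chain ?A C" for C
  proof -
    have "subset.chain {\<Delta>. classical_theory \<Delta>} C"
      using that(2) by (auto simp: subset_chain_def)
    then show ?thesis
      using classical_theory_Union_chain that by (auto simp: subset_chain_def)
  qed
  moreover have "?A \<noteq> {}"
    using assms by blast
  ultimately obtain w where w: "w \<in> ?A" and "\<forall>X\<in>?A. w \<subseteq> X \<longrightarrow> X = w"
    using subset_Zorn_nonempty[of ?A] by auto
  then have "maximal_consistent w"
    by (intro maximal_consistent_if_maximal_omitting[of w \<phi>]) auto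
  then show thesis
    using that w by blast
qed

lemma maximal_consistent_Imp_iff:
  assumes "maximal_consistent w"
  shows "\<phi> \<rightarrow>\<^sub>p \<psi> \<in> w \<longleftrightarrow> (\<phi> \<in> w \<longrightarrow> \<psi> \<in> w)"
proof -
  have w: "classical_theory w"
    using assms by (simp add: maximal_consistent_def)
  have "\<phi> \<rightarrow>\<^sub>p \<psi> \<in> w" if "\<not>\<^sub>p \<phi> \<in> w"
    using w that that by (rule classical_theory_consequence) auto
  moreover have "\<phi> \<rightarrow>\<^sub>p \<psi> \<in> w" if "\<psi> \<in> w"
    using w that that by (rule classical_theory_consequence) auto
  ultimately show ?thesis
    using assms classical_theory_MP[OF w] unfolding maximal_consistent_def by blast
qed

lemma maximal_consistent_Fls: "maximal_consistent w \<Longrightarrow> PFls \<notin> w"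
  by (simp add: maximal_consistent_def)

subsection \<open>Canonical models\<close>

definition canonical_rel :: "pfm set \<Rightarrow> pfm set \<Rightarrow> bool" where
  "canonical_rel w v \<longleftrightarrow> (\<forall>\<phi>. \<box>\<^sub>p \<phi> \<in> w \<longrightarrow> \<phi> \<in> v)"

locale normal_modal_logic =
  fixes \<Lambda> :: "pfm set"
  assumes classical: "classical_theory \<Lambda>"
    and K: "\<box>\<^sub>p (\<phi> \<rightarrow>\<^sub>p \<psi>) \<rightarrow>\<^sub>p \<box>\<^sub>p \<phi> \<rightarrow>\<^sub>p \<box>\<^sub>p \<psi> \<in> \<Lambda>"
    and Nec: "\<phi> \<in> \<Lambda> \<Longrightarrow> \<box>\<^sub>p \<phi> \<in> \<Lambda>"
begin

definition world :: "pfm set \<Rightarrow> bool" where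
  "world w \<longleftrightarrow> maximal_consistent w \<and> \<Lambda> \<subseteq> w"

lemma world_Imp_iff: "world w \<Longrightarrow> \<phi> \<rightarrow>\<^sub>p \<psi> \<in> w \<longleftrightarrow> (\<phi> \<in> w \<longrightarrow> \<psi> \<in> w)"
  by (simp add: world_def maximal_consistent_Imp_iff)

lemma world_Fls: "world w \<Longrightarrow> PFls \<notin> w"
  by (simp add: world_def maximal_consistent_Fls)

lemma world_MP: "world w \<Longrightarrow> \<phi> \<rightarrow>\<^sub>p \<psi> \<in> \<Lambda> \<Longrightarrow> \<phi> \<in> w \<Longrightarrow> \<psi> \<in> w"
  using world_Imp_iff by (auto simp: world_def)

lemma world_BoxMP: "world w \<Longrightarrow> \<box>\<^sub>p (\<phi> \<rightarrow>\<^sub>p \<psi>) \<in> w \<Longrightarrow> \<box>\<^sub>p \<phi> \<in> w \<Longrightarrow> \<box>\<^sub>p \<psi> \<in> w"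
  using world_MP[OF _ K] world_Imp_iff by blast

lemma refuting_world:
  assumes "\<phi> \<notin> \<Lambda>"
  obtains w where "world w" "\<phi> \<notin> w"
  using Lindenbaum[OF classical assms] unfolding world_def by blast

lemma classical_theory_Box:
  assumes "world w"
  shows "classical_theory {\<phi>. \<box>\<^sub>p \<phi> \<in> w}"
proof -
  have "\<box>\<^sub>p \<phi> \<in> w" if "tautology \<phi>" for \<phi>
    using Nec classical_theory_tautology[OF classical that] assms by (auto simp: world_def)
  then show ?thesis
    using world_BoxMP[OF assms] by (auto simp: classical_theory_def)
qed

lemma world_Box_iff:
  assumes w: "world w"
  shows "\<box>\<^sub>p \<phi> \<in> w \<longleftrightarrow> (\<forall>v. world v \<and> canonical_rel w v \<longrightarrow> \<phi> \<in> v)"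
proof
  assume all: "\<forall>v. world v \<and> canonical_rel w v \<longrightarrow> \<phi> \<in> v"
  show "\<box>\<^sub>p \<phi> \<in> w"
  proof (rule ccontr)
    assume "\<box>\<^sub>p \<phi> \<notin> w"
    then obtain v where v: "maximal_consistent v" "{\<phi>. \<box>\<^sub>p \<phi> \<in> w} \<subseteq> v" "\<phi> \<notin> v"
      using Lindenbaum[OF classical_theory_Box[OF w], of \<phi>] by blast
    moreover have "\<Lambda> \<subseteq> {\<phi>. \<box>\<^sub>p \<phi> \<in> w}"
      using w Nec by (auto simp: world_def)
    ultimately have "world v" "canonical_rel w v"
      by (auto simp: world_def canonical_rel_def)
    then show False
      using all v(3) by blast
  qed
qed (auto simp: canonical_rel_def)

lemma world_Dia_iff:
  assumes "world w"
  shows "\<diamond>\<^sub>p \<phi> \<in> w \<longleftrightarrow> (\<exists>v. world v \<and> canonical_rel w v \<and> \<phi> \<in> v)"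
  using assms by (auto simp: world_Imp_iff world_Fls world_Box_iff)

end

locale s4_logic = normal_modal_logic +
  assumes T: "\<box>\<^sub>p \<phi> \<rightarrow>\<^sub>p \<phi> \<in> \<Lambda>"
    and four: "\<box>\<^sub>p \<phi> \<rightarrow>\<^sub>p \<box>\<^sub>p \<box>\<^sub>p \<phi> \<in> \<Lambda>"
begin

lemma world_BoxD: "world w \<Longrightarrow> \<box>\<^sub>p \<phi> \<in> w \<Longrightarrow> \<phi> \<in> w"
  by (rule world_MP[OF _ T])

lemma world_BoxBox: "world w \<Longrightarrow> \<box>\<^sub>p \<phi> \<in> w \<Longrightarrow> \<box>\<^sub>p \<box>\<^sub>p \<phi> \<in> w"
  by (rule world_MP[OF _ four])

lemma canonical_refl: "world w \<Longrightarrow> canonical_rel w w"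
  by (simp add: canonical_rel_def world_BoxD)

lemma canonical_Box: "world w \<Longrightarrow> canonical_rel w v \<Longrightarrow> \<box>\<^sub>p \<phi> \<in> w \<Longrightarrow> \<box>\<^sub>p \<phi> \<in> v"
  using world_BoxBox unfolding canonical_rel_def by blast

lemma canonical_trans:
  "world u \<Longrightarrow> canonical_rel u v \<Longrightarrow> canonical_rel v w \<Longrightarrow> canonical_rel u w"
  using canonical_Box by (meson canonical_rel_def)

end

locale s421_logic = s4_logic +
  assumes dot2: "\<diamond>\<^sub>p \<box>\<^sub>p \<phi> \<rightarrow>\<^sub>p \<box>\<^sub>p \<diamond>\<^sub>p \<phi> \<in> \<Lambda>"
    and dot1: "\<box>\<^sub>p \<diamond>\<^sub>p \<phi> \<rightarrow>\<^sub>p \<diamond>\<^sub>p \<box>\<^sub>p \<phi> \<in> \<Lambda>"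
begin

text \<open>Axiom \<open>dot1\<close> makes this set decide every formula, and axiom \<open>dot2\<close> makes it closed under
  modus ponens: it is the unique final world above \<open>w\<close>.\<close>

definition final :: "pfm set \<Rightarrow> pfm set" where
  "final w = {\<phi>. \<diamond>\<^sub>p \<box>\<^sub>p \<phi> \<in> w}"

lemma mem_final_iff:
  assumes "world w"
  shows "\<phi> \<in> final w \<longleftrightarrow> (\<exists>v. world v \<and> canonical_rel w v \<and> \<box>\<^sub>p \<phi> \<in> v)"
  using world_Dia_iff[OF assms] by (simp add: final_def)

lemma canonical_final:
  assumes "world w"
  shows "canonical_rel w (final w)"
  using canonical_refl[OF assms] assms by (auto simp: canonical_rel_def[of w "final w"] mem_final_iff)

lemma Box_final_iff:
  assumes "world w"
  shows "\<box>\<^sub>p \<phi> \<in> final w \<longleftrightarrow> \<phi> \<in> final w"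
  unfolding mem_final_iff[OF assms] using world_BoxD world_BoxBox by blast

lemma final_upward:
  assumes w: "world w" and v: "world v" "canonical_rel w v"
  shows "final v = final w"
proof
  show "final v \<subseteq> final w"
    using canonical_trans[OF w v(2)] mem_final_iff[OF w] mem_final_iff[OF v(1)] by blast
  show "final w \<subseteq> final v"
  proof
    fix \<phi> assume "\<phi> \<in> final w"
    then have "\<diamond>\<^sub>p \<box>\<^sub>p \<box>\<^sub>p \<phi> \<in> w"
      using Box_final_iff[OF w] by (simp add: final_def)
    then have "\<box>\<^sub>p \<diamond>\<^sub>p \<box>\<^sub>p \<phi> \<in> w"
      using world_MP[OF w dot2] by blast
    then show "\<phi> \<in> final v"
      using v(2) by (simp add: final_def canonical_rel_def)
  qed
qed

lemma final_MP:
  assumes w: "world w" and "\<phi> \<rightarrow>\<^sub>p \<psi> \<in> final w" "\<phi> \<in> final w"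
  shows "\<psi> \<in> final w"
proof -
  obtain v where v: "world v" "canonical_rel w v" "\<box>\<^sub>p (\<phi> \<rightarrow>\<^sub>p \<psi>) \<in> v"
    using assms by (auto simp: mem_final_iff)
  then have "\<phi> \<in> final v"
    using assms final_upward by simp
  then obtain u where u: "world u" "canonical_rel v u" "\<box>\<^sub>p \<phi> \<in> u"
    using v by (auto simp: mem_final_iff)
  then have "\<box>\<^sub>p \<psi> \<in> u"
    using world_BoxMP canonical_Box v by blast
  then show ?thesis
    unfolding mem_final_iff[OF w] using canonical_trans[OF w v(2) u(2)] u(1) by blast
qed

lemma final_complete:
  assumes w: "world w"
  shows "\<phi> \<in> final w \<or> \<not>\<^sub>p \<phi> \<in> final w"
proof (rule disjCI)
  assume "\<not>\<^sub>p \<phi> \<notin> final w"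
  then have "\<box>\<^sub>p \<diamond>\<^sub>p \<not>\<^sub>p \<phi> \<notin> w"
    using world_MP[OF w dot1] by (auto simp: final_def)
  then obtain v where v: "world v" "canonical_rel w v" "\<diamond>\<^sub>p \<not>\<^sub>p \<phi> \<notin> v"
    using world_Box_iff[OF w] by blast
  then have "\<box>\<^sub>p \<phi> \<in> v"
    using world_Dia_iff[OF v(1)] world_Box_iff[OF v(1)] world_Imp_iff world_Fls by metis
  then show "\<phi> \<in> final w"
    unfolding mem_final_iff[OF w] using v by blast
qed

lemma world_final:
  assumes w: "world w"
  shows "world (final w)"
proof -
  have "\<Lambda> \<subseteq> final w"
    using canonical_final[OF w] w Nec by (auto simp: world_def canonical_rel_def)
  moreover have "PFls \<notin> final w"
    unfolding mem_final_iff[OF w] using world_BoxD world_Fls by blast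
  ultimately show ?thesis
    using final_MP[OF w] final_complete[OF w] classical
    unfolding world_def maximal_consistent_def classical_theory_def by blast
qed

end

lemma S421_axiom_instance:
  assumes "\<chi> \<in> {\<box>\<^sub>p PVar 0 \<rightarrow>\<^sub>p PVar 0, \<box>\<^sub>p PVar 0 \<rightarrow>\<^sub>p \<box>\<^sub>p \<box>\<^sub>p PVar 0,
    \<diamond>\<^sub>p \<box>\<^sub>p PVar 0 \<rightarrow>\<^sub>p \<box>\<^sub>p \<diamond>\<^sub>p PVar 0, \<box>\<^sub>p \<diamond>\<^sub>p PVar 0 \<rightarrow>\<^sub>p \<diamond>\<^sub>p \<box>\<^sub>p PVar 0}"
  shows "psubst \<sigma> \<chi> \<in> S421"
  unfolding S421_def Let_def using assms by (intro normal_logic.Sub normal_logic.ax)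

interpretation S421: s421_logic S421
proof
  show "classical_theory S421"
    unfolding classical_theory_def S421_def Let_def
    by (auto intro: normal_logic.taut normal_logic.MP)
  fix \<phi> \<psi>
  show "\<box>\<^sub>p (\<phi> \<rightarrow>\<^sub>p \<psi>) \<rightarrow>\<^sub>p \<box>\<^sub>p \<phi> \<rightarrow>\<^sub>p \<box>\<^sub>p \<psi> \<in> S421"
    unfolding S421_def Let_def by (rule normal_logic.K)
  show "\<box>\<^sub>p \<phi> \<in> S421" if "\<phi> \<in> S421"
    using that unfolding S421_def Let_def by (rule normal_logic.Nec)
  show "\<box>\<^sub>p \<phi> \<rightarrow>\<^sub>p \<phi> \<in> S421"
    using S421_axiom_instance[of "\<box>\<^sub>p PVar 0 \<rightarrow>\<^sub>p PVar 0" "\<lambda>_. \<phi>"] by simp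
  show "\<box>\<^sub>p \<phi> \<rightarrow>\<^sub>p \<box>\<^sub>p \<box>\<^sub>p \<phi> \<in> S421"
    using S421_axiom_instance[of "\<box>\<^sub>p PVar 0 \<rightarrow>\<^sub>p \<box>\<^sub>p \<box>\<^sub>p PVar 0" "\<lambda>_. \<phi>"] by simp
  show "\<diamond>\<^sub>p \<box>\<^sub>p \<phi> \<rightarrow>\<^sub>p \<box>\<^sub>p \<diamond>\<^sub>p \<phi> \<in> S421"
    using S421_axiom_instance[of "\<diamond>\<^sub>p \<box>\<^sub>p PVar 0 \<rightarrow>\<^sub>p \<box>\<^sub>p \<diamond>\<^sub>p PVar 0" "\<lambda>_. \<phi>"] by simp
  show "\<box>\<^sub>p \<diamond>\<^sub>p \<phi> \<rightarrow>\<^sub>p \<diamond>\<^sub>p \<box>\<^sub>p \<phi> \<in> S421"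
    using S421_axiom_instance[of "\<box>\<^sub>p \<diamond>\<^sub>p PVar 0 \<rightarrow>\<^sub>p \<diamond>\<^sub>p \<box>\<^sub>p PVar 0" "\<lambda>_. \<phi>"] by simp
qed

subsection \<open>Completeness for finite frames with one final point\<close>

fun forces :: "'w set \<Rightarrow> ('w \<Rightarrow> 'w \<Rightarrow> bool) \<Rightarrow> (nat \<Rightarrow> 'w \<Rightarrow> bool) \<Rightarrow> 'w \<Rightarrow> pfm \<Rightarrow> bool" where
  "forces F R v w (PVar n) \<longleftrightarrow> v n w"
| "forces F R v w PFls \<longleftrightarrow> False"
| "forces F R v w (\<phi> \<rightarrow>\<^sub>p \<psi>) \<longleftrightarrow> (forces F R v w \<phi> \<longrightarrow> forces F R v w \<psi>)"
| "forces F R v w (\<box>\<^sub>p \<phi>) \<longleftrightarrow> (\<forall>u\<in>F. R w u \<longrightarrow> forces F R v u \<phi>)"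

locale topped_frame =
  fixes F :: "'w set" and R :: "'w \<Rightarrow> 'w \<Rightarrow> bool" and r t :: 'w
  assumes finite: "finite F" and root_in: "r \<in> F" and top_in: "t \<in> F"
    and refl: "reflp_on F R" and trans: "transp R"
    and below_top: "u \<in> F \<Longrightarrow> R u t"
    and top_final: "R t u \<Longrightarrow> u = t"

fun subformulas :: "pfm \<Rightarrow> pfm set" where
  "subformulas (PVar n) = {PVar n}"
| "subformulas PFls = {PFls}"
| "subformulas (\<phi> \<rightarrow>\<^sub>p \<psi>) = insert (\<phi> \<rightarrow>\<^sub>p \<psi>) (subformulas \<phi> \<union> subformulas \<psi>)"
| "subformulas (\<box>\<^sub>p \<phi>) = insert (\<box>\<^sub>p \<phi>) (subformulas \<phi>)"

lemma finite_subformulas: "finite (subformulas \<phi>)"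
  by (induction \<phi>) auto

lemma subformulas_self: "\<phi> \<in> subformulas \<phi>"
  by (cases \<phi>) auto

lemma subformulas_trans: "\<phi> \<in> subformulas \<psi> \<Longrightarrow> subformulas \<phi> \<subseteq> subformulas \<psi>"
  by (induction \<psi>) auto

locale filtration = s421_logic +
  fixes w\<^sub>0 :: "pfm set" and \<Sigma> :: "pfm set"
  assumes w\<^sub>0: "world w\<^sub>0" and finite: "finite \<Sigma>"
    and closed: "\<phi> \<in> \<Sigma> \<Longrightarrow> subformulas \<phi> \<subseteq> \<Sigma>"
begin

definition points :: "pfm set set" where
  "points = {w \<inter> \<Sigma> | w. world w \<and> canonical_rel w\<^sub>0 w}"

abbreviation final_point :: "pfm set" where
  "final_point \<equiv> final w\<^sub>0 \<inter> \<Sigma>"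

text \<open>Lemmon's filtration of the canonical model, except that the trace of the final world is made
  to see only itself. This is harmless, since \<open>\<box>\<^sub>p \<phi>\<close> and \<open>\<phi>\<close> are equivalent in the final world.\<close>

definition filtration_rel :: "pfm set \<Rightarrow> pfm set \<Rightarrow> bool" where
  "filtration_rel u v \<longleftrightarrow> v = final_point \<or> u \<noteq> final_point \<and> (\<forall>\<phi>. \<box>\<^sub>p \<phi> \<in> u \<longrightarrow> \<box>\<^sub>p \<phi> \<in> v)"

lemma closed_Imp: "\<phi> \<rightarrow>\<^sub>p \<psi> \<in> \<Sigma> \<Longrightarrow> \<phi> \<in> \<Sigma> \<and> \<psi> \<in> \<Sigma>"
  using closed[of "\<phi> \<rightarrow>\<^sub>p \<psi>"] subformulas_self by auto

lemma closed_Box: "\<box>\<^sub>p \<phi> \<in> \<Sigma> \<Longrightarrow> \<phi> \<in> \<Sigma>"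
  using closed[of "\<box>\<^sub>p \<phi>"] subformulas_self by auto

lemma pointE:
  assumes "u \<in> points"
  obtains w where "u = w \<inter> \<Sigma>" "world w" "canonical_rel w\<^sub>0 w"
  using assms by (auto simp: points_def)

lemma final_in_points: "final_point \<in> points"
  using world_final[OF w\<^sub>0] canonical_final[OF w\<^sub>0] by (auto simp: points_def)

lemma root_in_points: "w\<^sub>0 \<inter> \<Sigma> \<in> points"
  using w\<^sub>0 canonical_refl[OF w\<^sub>0] by (auto simp: points_def)

lemma Box_final_point:
  assumes "u \<in> points" "\<box>\<^sub>p \<phi> \<in> u"
  shows "\<phi> \<in> final_point"
proof -
  obtain w where w: "u = w \<inter> \<Sigma>" "world w" "canonical_rel w\<^sub>0 w"
    using assms(1) by (rule pointE)
  then have "\<phi> \<in> final w"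
    using canonical_final[OF w(2)] assms(2) by (simp add: canonical_rel_def)
  then show ?thesis
    using final_upward[OF w\<^sub>0 w(2,3)] w(1) assms(2) closed_Box by blast
qed

lemma filtration_rel_Box:
  assumes u: "u \<in> points" "\<box>\<^sub>p \<phi> \<in> u" and v: "v \<in> points" "filtration_rel u v"
  shows "\<phi> \<in> v"
proof (cases "v = final_point")
  case True
  then show ?thesis
    using Box_final_point[OF u] by simp
next
  case False
  then have "\<box>\<^sub>p \<phi> \<in> v"
    using u v by (simp add: filtration_rel_def)
  moreover obtain w where w: "v = w \<inter> \<Sigma>" "world w"
    using v(1) by (rule pointE)
  ultimately have "\<box>\<^sub>p \<phi> \<in> \<Sigma>" "\<phi> \<in> w"
    using world_BoxD[OF w(2)] by auto
  then show ?thesis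
    using w(1) closed_Box by blast
qed

lemma filtration_rel_Box_witness:
  assumes u: "u \<in> points" and \<phi>: "\<box>\<^sub>p \<phi> \<in> \<Sigma>" "\<box>\<^sub>p \<phi> \<notin> u"
  shows "\<exists>v\<in>points. filtration_rel u v \<and> \<phi> \<notin> v"
proof (cases "u = final_point")
  case True
  then show ?thesis
    using \<phi> Box_final_iff[OF w\<^sub>0] final_in_points by (auto simp: filtration_rel_def)
next
  case False
  obtain w where w: "u = w \<inter> \<Sigma>" "world w" "canonical_rel w\<^sub>0 w"
    using u by (rule pointE)
  then obtain v where v: "world v" "canonical_rel w v" "\<phi> \<notin> v"
    using \<phi> world_Box_iff by blast
  have "v \<inter> \<Sigma> \<in> points"
    using v(1) canonical_trans[OF w\<^sub>0 w(3) v(2)] by (auto simp: points_def)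
  moreover have "filtration_rel u (v \<inter> \<Sigma>)"
    using False w canonical_Box[OF w(2) v(2)] by (auto simp: filtration_rel_def)
  ultimately show ?thesis
    using v(3) by blast
qed

lemma forces_iff_mem:
  assumes "\<phi> \<in> \<Sigma>" "u \<in> points"
  shows "forces points filtration_rel (\<lambda>n u. PVar n \<in> u) u \<phi> \<longleftrightarrow> \<phi> \<in> u"
  using assms
proof (induction \<phi> arbitrary: u)
  case PFls
  then show ?case
    by (auto simp: world_Fls elim: pointE)
next
  case (PImp \<phi> \<psi>)
  obtain w where "u = w \<inter> \<Sigma>" "world w"
    using PImp.prems(2) by (rule pointE)
  moreover have "\<phi> \<in> \<Sigma>" "\<psi> \<in> \<Sigma>"
    using closed_Imp[OF PImp.prems(1)] by simp_all
  ultimately show ?case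
    using PImp by (simp add: world_Imp_iff)
next
  case (PBox \<phi>)
  have "\<phi> \<in> \<Sigma>"
    using PBox.prems(1) by (rule closed_Box)
  then have "forces points filtration_rel (\<lambda>n u. PVar n \<in> u) u (\<box>\<^sub>p \<phi>) \<longleftrightarrow>
      (\<forall>v\<in>points. filtration_rel u v \<longrightarrow> \<phi> \<in> v)"
    using PBox.IH by simp
  then show ?case
    using filtration_rel_Box filtration_rel_Box_witness PBox.prems by blast
qed simp

lemma topped_frame: "topped_frame points filtration_rel (w\<^sub>0 \<inter> \<Sigma>) final_point"
proof
  have "points \<subseteq> Pow \<Sigma>"
    by (auto simp: points_def)
  then show "finite points"
    using finite by (simp add: finite_subset)
  show "reflp_on points filtration_rel"
    by (auto simp: reflp_on_def filtration_rel_def)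
  show "transp filtration_rel"
    unfolding transp_on_def filtration_rel_def by blast
qed (use final_in_points root_in_points in \<open>auto simp: filtration_rel_def\<close>)

end

theorem S421_complete:
  assumes "\<psi> \<notin> S421"
  obtains F :: "pfm set set" and R r t v where "topped_frame F R r t" "\<not> forces F R v r \<psi>"
proof -
  obtain w where w: "S421.world w" "\<psi> \<notin> w"
    using S421.refuting_world[OF assms] by blast
  interpret filtration S421 w "subformulas \<psi>"
    by unfold_locales (simp_all add: w(1) finite_subformulas subformulas_trans)
  have "\<not> forces points filtration_rel (\<lambda>n u. PVar n \<in> u) (w \<inter> subformulas \<psi>) \<psi>"
    using forces_iff_mem[OF subformulas_self root_in_points] w(2) by simp
  then show thesis
    using that topped_frame by blast
qed

subsection \<open>Soundness\<close>

lemma condensation_id: "condensation U U id"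
  by (simp add: condensation_def)

lemma condensation_comp:
  "condensation U V f \<Longrightarrow> condensation V W g \<Longrightarrow> condensation U W (g \<circ> f)"
  unfolding condensation_def by (metis comp_apply image_comp)

lemma lo_point: "lo {(a, a)}"
  by (auto simp: lo_def order_on_defs Field_def refl_on_def trans_def antisym_def total_on_def)

lemma condensation_point: "lo U \<Longrightarrow> condensation U {(a, a)} (\<lambda>_. a)"
  by (auto simp: lo_def condensation_def Field_def)

abbreviation sat_point :: "'a \<Rightarrow> 'c fm \<Rightarrow> bool" where
  "sat_point a \<equiv> sat {(a, a)} (\<lambda>_. a) (\<lambda>_. a)"

lemma sat_condensed_point:
  fixes V :: "'b rel"
  assumes "lo V" "condensation {(a, a)} V f"
  shows "sat V (f \<circ> (\<lambda>_. a)) (f \<circ> (\<lambda>_. a)) \<phi> \<longleftrightarrow> sat_point a \<phi>"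
proof -
  have "oiso {(a, a)} V f"
    using assms(2) by (auto simp: condensation_def oiso_def bij_betw_def Field_def)
  from sat_oiso[OF lo_point assms(1) this, of \<phi> "\<lambda>_. a" "\<lambda>_. a"] show ?thesis
    by (simp add: Field_def)
qed

lemma sat_point_Box_iff: "sat_point a (Box \<phi>) \<longleftrightarrow> sat_point a \<phi>"
  unfolding sat.simps(6)
  using sat_condensed_point[where a = a] lo_point[of a] condensation_id[of "{(a, a)}"] by metis

lemma sat_point_if_Box:
  fixes V :: "'a rel" and a :: 'a
  assumes "lo V" "sat V \<iota> \<nu> (Box \<phi>)"
  shows "sat_point a \<phi>"
  using assms lo_point[of a] condensation_point[of V a] by (auto simp: comp_def)

lemma sat_Dia_if_point:
  fixes V :: "'a rel" and a :: 'a
  assumes "lo V" "sat_point a \<phi>"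
  shows "sat V \<iota> \<nu> (Dia \<phi>)"
  unfolding sat_Dia using assms lo_point[of a] condensation_point[of V a]
  by (force simp: comp_def)

lemma sat_T: "lo U \<Longrightarrow> sat U \<iota> \<nu> (Imp (Box \<phi>) \<phi>)"
  using condensation_id[of U] by (auto dest!: spec[of _ U] spec[of _ id])

lemma sat_4: "sat U \<iota> \<nu> (Imp (Box \<phi>) (Box (Box \<phi>)))"
  using condensation_comp[of U] by (fastforce simp: comp_assoc)

lemma sat_dot2:
  fixes U :: "'a rel"
  shows "sat U \<iota> \<nu> (Imp (Dia (Box \<phi>)) (Box (Dia \<phi>)))"
proof (subst sat.simps(4), rule impI)
  fix a :: 'a
  assume "sat U \<iota> \<nu> (Dia (Box \<phi>))"
  then obtain V :: "'a rel" and f where "lo V" "sat V (f \<circ> \<iota>) (f \<circ> \<nu>) (Box \<phi>)"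
    unfolding sat_Dia by blast
  then have "sat_point a \<phi>"
    by (rule sat_point_if_Box)
  then show "sat U \<iota> \<nu> (Box (Dia \<phi>))"
    unfolding sat.simps(6) by (intro allI impI sat_Dia_if_point) simp_all
qed

lemma sat_dot1:
  fixes U :: "'a rel"
  assumes U: "lo U"
  shows "sat U \<iota> \<nu> (Imp (Box (Dia \<phi>)) (Dia (Box \<phi>)))"
proof (subst sat.simps(4), rule impI)
  fix a :: 'a
  assume "sat U \<iota> \<nu> (Box (Dia \<phi>))"
  then have "sat_point a (Dia \<phi>)"
    by (rule sat_point_if_Box[OF U])
  then have "sat_point a (Box \<phi>)"
    by (simp del: sat.simps(6) add: sat_point_Box_iff)
  then show "sat U \<iota> \<nu> (Dia (Box \<phi>))"
    by (rule sat_Dia_if_point[OF U])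
qed

lemma inst_psubst: "inst \<sigma> (psubst \<tau> \<phi>) = inst (\<lambda>n. inst \<sigma> (\<tau> n)) \<phi>"
  by (induction \<phi>) auto

lemma sat_inst_peval: "sat U \<iota> \<nu> (inst \<sigma> \<phi>) \<longleftrightarrow> peval (\<lambda>\<chi>. sat U \<iota> \<nu> (inst \<sigma> \<chi>)) \<phi>"
  by (induction \<phi>) auto

lemma sat_inst_S421:
  assumes "\<psi> \<in> S421" "lo U"
  shows "sat U \<iota> \<nu> (inst \<sigma> \<psi>)"
  using assms unfolding S421_def Let_def
proof (induction arbitrary: U \<iota> \<nu> \<sigma> rule: normal_logic.induct)
  case (taut \<phi>)
  then show ?case
    by (subst sat_inst_peval) (simp add: tautology_def)
next
  case (ax \<phi>)
  then show ?case
    using sat_T[OF ax(2)] sat_4 sat_dot2 sat_dot1[OF ax(2)] by (auto simp del: sat.simps)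
next
  case (Sub \<phi> \<tau>)
  then show ?case
    by (simp add: inst_psubst)
qed auto

corollary S421_subset_Val: "lo W \<Longrightarrow> S421 \<subseteq> Val W (lang W)"
  by (auto simp: Val_def holds_def sat_inst_S421)

subsection \<open>Condensations of linear orders\<close>

lemma lo_refl: "lo V \<Longrightarrow> x \<in> Field V \<Longrightarrow> (x, x) \<in> V"
  by (auto simp: lo_def order_on_defs refl_on_def)

lemma lo_trans: "lo V \<Longrightarrow> (x, y) \<in> V \<Longrightarrow> (y, z) \<in> V \<Longrightarrow> (x, z) \<in> V"
  by (rule transD[of V]) (simp_all add: lo_def order_on_defs)

lemma lo_antisym: "lo V \<Longrightarrow> (x, y) \<in> V \<Longrightarrow> (y, x) \<in> V \<Longrightarrow> x = y"
  by (rule antisymD[of V]) (simp_all add: lo_def order_on_defs)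

lemma lo_total: "lo V \<Longrightarrow> x \<in> Field V \<Longrightarrow> y \<in> Field V \<Longrightarrow> (x, y) \<in> V \<or> (y, x) \<in> V"
  by (cases "x = y") (auto simp: lo_refl, auto simp: lo_def order_on_defs total_on_def)

lemma condensation_mono: "condensation V W f \<Longrightarrow> (x, y) \<in> V \<Longrightarrow> (f x, f y) \<in> W"
  by (simp add: condensation_def)

lemma condensation_in_Field: "condensation V W f \<Longrightarrow> x \<in> Field V \<Longrightarrow> f x \<in> Field W"
  by (auto simp: condensation_def)

lemma condensation_le_iff:
  assumes V: "lo V" and W: "lo W" and f: "condensation V W f"
    and x: "x \<in> Field V" and y: "y \<in> Field V"
  shows "(f x, f y) \<in> W \<longleftrightarrow> (x, y) \<in> V \<or> f x = f y"
proof
  assume "(f x, f y) \<in> W"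
  then show "(x, y) \<in> V \<or> f x = f y"
    using lo_total[OF V x y] condensation_mono[OF f] lo_antisym[OF W] by blast
next
  assume "(x, y) \<in> V \<or> f x = f y"
  then show "(f x, f y) \<in> W"
    using condensation_mono[OF f] lo_refl[OF W condensation_in_Field[OF f x]] by metis
qed

lemma condensation_convex_fibre:
  assumes "lo W" "condensation V W f" "(x, y) \<in> V" "(y, z) \<in> V" "f x = f z"
  shows "f y = f x"
  using assms condensation_mono[OF assms(2)] lo_antisym[OF assms(1)] by metis

lemma condensation_aboveE:
  assumes V: "lo V" and W: "lo W" and f: "condensation V W f"
    and c: "c \<in> Field V" and w: "(f c, w) \<in> W"
  obtains x where "(c, x) \<in> V" "f x = w"
proof -
  have "w \<in> f ` Field V"
    using FieldI2[OF w] f by (simp add: condensation_def)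
  then obtain x where x: "x \<in> Field V" "w = f x"
    by blast
  then consider "(c, x) \<in> V" | "w = f c"
    using condensation_le_iff[OF V W f c] w by auto
  then show thesis
    using that x lo_refl[OF V c] by cases auto
qed

lemma map_prod_image_iff_if_convex_fibres:
  assumes V: "lo V" and x: "x \<in> Field V" and y: "y \<in> Field V"
    and convex: "\<And>x y z. (x, y) \<in> V \<Longrightarrow> (y, z) \<in> V \<Longrightarrow> p x = p z \<Longrightarrow> p y = p x"
  shows "(p x, p y) \<in> map_prod p p ` V \<longleftrightarrow> (x, y) \<in> V \<or> p x = p y"
proof
  assume "(p x, p y) \<in> map_prod p p ` V"
  then obtain x' y' where le: "(x', y') \<in> V" and eq: "p x' = p x" "p y' = p y"
    by auto
  consider "(x, y) \<in> V" | "(y', x) \<in> V" | "(y, x) \<in> V" "(x, y') \<in> V"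
    using lo_total[OF V x y] lo_total[OF V x FieldI2[OF le]] by blast
  then show "(x, y) \<in> V \<or> p x = p y"
    using convex[of x' y' x] convex[of y x y'] le eq by cases auto
next
  assume "(x, y) \<in> V \<or> p x = p y"
  then show "(p x, p y) \<in> map_prod p p ` V"
    using lo_refl[OF V y] by force
qed

lemma ex_condensation_if_convex_fibres:
  assumes V: "lo V"
    and convex: "\<And>x y z. (x, y) \<in> V \<Longrightarrow> (y, z) \<in> V \<Longrightarrow> p x = p z \<Longrightarrow> p y = p x"
  obtains W where "lo W" "condensation V W p"
proof -
  define W where "W = map_prod p p ` V"
  have Field_W: "Field W = p ` Field V"
    by (force simp: W_def Field_def)
  have le_iff: "(p x, p y) \<in> W \<longleftrightarrow> (x, y) \<in> V \<or> p x = p y" if "x \<in> Field V" "y \<in> Field V" for x y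
    unfolding W_def using V that convex by (rule map_prod_image_iff_if_convex_fibres)
  have W_mono: "(p x, p y) \<in> W" if "(x, y) \<in> V" for x y
    using that by (force simp: W_def)
  have "(p x, p z) \<in> W" if le: "(x, y) \<in> V" "(y', z) \<in> V" and eq: "p y = p y'" for x y y' z
  proof -
    have "(y, z) \<in> V \<or> p y = p z"
      using le_iff[OF FieldI2[OF le(1)] FieldI2[OF le(2)]] W_mono[OF le(2)] eq by simp
    then show ?thesis
      using W_mono lo_trans[OF V le(1)] W_mono[OF le(1)] by auto
  qed
  then have "trans W"
    unfolding W_def by (auto intro!: transI)
  moreover have "p x = p y"
    if le: "(x, y) \<in> V" "(y', x') \<in> V" and eq: "p x = p x'" "p y = p y'" for x y x' y'
    using le_iff[OF FieldI2[OF le(1)] FieldI1[OF le(1)]] lo_antisym[OF V le(1)] W_mono[OF le(2)] eq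
    by auto
  then have "antisym W"
    unfolding W_def by (auto intro!: antisymI)
  moreover have "refl_on (Field W) W" "total_on (Field W) W"
    using lo_refl[OF V] lo_total[OF V] le_iff unfolding Field_W refl_on_def total_on_def by auto
  moreover have "W \<subseteq> Field W \<times> Field W"
    by (auto intro: FieldI1 FieldI2)
  ultimately have "lo W"
    using V Field_W by (simp add: lo_def order_on_defs)
  moreover have "condensation V W p"
    using Field_W by (force simp: condensation_def W_def)
  ultimately show thesis
    by (rule that)
qed

definition order_convex :: "'a rel \<Rightarrow> 'a set \<Rightarrow> bool" where
  "order_convex V A \<longleftrightarrow> (\<forall>x\<in>A. \<forall>z\<in>A. \<forall>y. (x, y) \<in> V \<longrightarrow> (y, z) \<in> V \<longrightarrow> y \<in> A)"

definition collapse :: "'a set \<Rightarrow> 'a \<Rightarrow> 'a \<Rightarrow> 'a" where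
  "collapse A a x = (if x \<in> A then a else x)"

lemma collapse_eq_iff: "a \<in> A \<Longrightarrow> collapse A a x = collapse A a y \<longleftrightarrow> x = y \<or> x \<in> A \<and> y \<in> A"
  by (auto simp: collapse_def)

lemma collapse_fixes: "(x \<in> A \<Longrightarrow> x = a) \<Longrightarrow> collapse A a x = x"
  by (auto simp: collapse_def)

lemma ex_condensation_collapse:
  assumes V: "lo V" and A: "order_convex V A" "a \<in> A"
  obtains W where "lo W" "condensation V W (collapse A a)"
proof (rule ex_condensation_if_convex_fibres[OF V])
  fix x y z
  assume "(x, y) \<in> V" "(y, z) \<in> V" "collapse A a x = collapse A a z"
  then show "collapse A a y = collapse A a x"
    using A lo_antisym[OF V] unfolding collapse_eq_iff[OF A(2)] order_convex_def by blast
qed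

subsection \<open>Covers and density\<close>

definition covers :: "'a rel \<Rightarrow> 'a \<Rightarrow> 'a \<Rightarrow> bool" where
  "covers V x y \<longleftrightarrow>
     (x, y) \<in> V \<and> x \<noteq> y \<and> (\<forall>z. (x, z) \<in> V \<longrightarrow> (z, y) \<in> V \<longrightarrow> z = x \<or> z = y)"

primrec covering_chain :: "'a rel \<Rightarrow> nat \<Rightarrow> 'a \<Rightarrow> bool" where
  "covering_chain V 0 x \<longleftrightarrow> True"
| "covering_chain V (Suc j) x \<longleftrightarrow> (\<exists>y. covers V x y \<and> covering_chain V j y)"

definition dense_above :: "'a rel \<Rightarrow> 'a \<Rightarrow> bool" where
  "dense_above V c \<longleftrightarrow>
     (\<exists>y. (c, y) \<in> V \<and> c \<noteq> y) \<and> (\<forall>x y. (c, x) \<in> V \<longrightarrow> \<not> covers V x y)"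

definition possibly_dense_above :: "'a rel \<Rightarrow> 'a \<Rightarrow> bool" where
  "possibly_dense_above V c \<longleftrightarrow>
     (\<exists>(W :: 'a rel) f. lo W \<and> condensation V W f \<and> dense_above W (f c))"

lemma dense_above_Field: "dense_above V c \<Longrightarrow> c \<in> Field V"
  by (auto simp: dense_above_def intro: FieldI1)

lemma covering_chain_if_dense_above:
  assumes "lo V" "dense_above V c"
  shows "covering_chain V j c \<longleftrightarrow> j = 0"
  using assms lo_refl[OF assms(1) dense_above_Field[OF assms(2)]]
  by (cases j) (auto simp: dense_above_def)

lemma covers_unique:
  assumes "lo V" "covers V x y" "covers V x z"
  shows "y = z"
  using assms lo_total[OF assms(1), of y z] FieldI2 unfolding covers_def by metis

lemma covers_condensation_iff:
  assumes V: "lo V" and W: "lo W" and f: "condensation V W f"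
    and x: "x \<in> Field V" and y: "y \<in> Field V"
  shows "covers W (f x) (f y) \<longleftrightarrow> (x, y) \<in> V \<and> f x \<noteq> f y \<and>
    (\<forall>z. (x, z) \<in> V \<longrightarrow> (z, y) \<in> V \<longrightarrow> f z = f x \<or> f z = f y)"
    (is "?covers \<longleftrightarrow> ?separates")
proof
  show ?separates if ?covers
    using that condensation_mono[OF f] condensation_le_iff[OF assms]
    unfolding covers_def by blast
  show ?covers if separates: ?separates
    unfolding covers_def
  proof (intro conjI allI impI)
    show "(f x, f y) \<in> W" "f x \<noteq> f y"
      using separates condensation_mono[OF f] by auto
    fix w
    assume w: "(f x, w) \<in> W" "(w, f y) \<in> W"
    obtain z where z: "(x, z) \<in> V" "f z = w"
      using condensation_aboveE[OF V W f x w(1)] .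
    then have "(z, y) \<in> V \<or> w = f y"
      using condensation_le_iff[OF V W f FieldI2[OF z(1)] y] w(2) by blast
    then show "w = f x \<or> w = f y"
      using separates z by blast
  qed
qed

text \<open>Condensations with the same kernel on the part above \<open>c\<close> have isomorphic images of that part.\<close>

locale equal_kernels_above =
  fixes V :: "'a rel" and W :: "'b rel" and U :: "'d rel"
    and f :: "'a \<Rightarrow> 'b" and g :: "'a \<Rightarrow> 'd" and c :: 'a
  assumes lo: "lo V" "lo W" "lo U"
    and condensations: "condensation V W f" "condensation V U g"
    and kernel: "(c, x) \<in> V \<Longrightarrow> (c, y) \<in> V \<Longrightarrow> f x = f y \<longleftrightarrow> g x = g y"
begin

lemma swap: "equal_kernels_above V U W g f c"
  using lo condensations kernel by unfold_locales auto

lemma covers_iff: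
  assumes x: "(c, x) \<in> V" and y: "(c, y) \<in> V"
  shows "covers W (f x) (f y) \<longleftrightarrow> covers U (g x) (g y)"
proof -
  have "f z = f x \<or> f z = f y \<longleftrightarrow> g z = g x \<or> g z = g y" if "(x, z) \<in> V" for z
    using kernel lo_trans[OF lo(1) x that] x y by metis
  then show ?thesis
    using covers_condensation_iff[OF lo(1,2) condensations(1) FieldI2[OF x] FieldI2[OF y]]
      covers_condensation_iff[OF lo(1,3) condensations(2) FieldI2[OF x] FieldI2[OF y]]
      kernel[OF x y] by auto
qed

lemma covering_chain_imp:
  "covering_chain W j (f x) \<Longrightarrow> (c, x) \<in> V \<Longrightarrow> covering_chain U j (g x)"
proof (induction j arbitrary: x)
  case (Suc j)
  obtain w where w: "covers W (f x) w" "covering_chain W j w"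
    using Suc.prems(1) by auto
  then have "(f x, w) \<in> W"
    by (simp add: covers_def)
  then obtain y where y: "(x, y) \<in> V" "f y = w"
    using condensation_aboveE[OF lo(1,2) condensations(1) FieldI2[OF Suc.prems(2)]] by blast
  moreover have "(c, y) \<in> V"
    using lo_trans[OF lo(1) Suc.prems(2) y(1)] .
  ultimately show ?case
    using Suc.IH covers_iff Suc.prems(2) w by auto
qed simp

lemma covering_chain_iff:
  assumes "(c, x) \<in> V"
  shows "covering_chain W j (f x) \<longleftrightarrow> covering_chain U j (g x)"
  using covering_chain_imp equal_kernels_above.covering_chain_imp[OF swap] assms by blast

lemma dense_above_imp:
  assumes dense: "dense_above W (f c)" and c: "c \<in> Field V"
  shows "dense_above U (g c)"
  unfolding dense_above_def
proof (intro conjI allI impI notI)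
  obtain w where w: "(f c, w) \<in> W" "f c \<noteq> w"
    using dense by (auto simp: dense_above_def)
  obtain y where y: "(c, y) \<in> V" "f y = w"
    using condensation_aboveE[OF lo(1,2) condensations(1) c w(1)] .
  then have "g c \<noteq> g y"
    using kernel[OF lo_refl[OF lo(1) c] y(1)] w(2) by simp
  then show "\<exists>y. (g c, y) \<in> U \<and> g c \<noteq> y"
    using condensation_mono[OF condensations(2) y(1)] by blast
  fix u v
  assume u: "(g c, u) \<in> U" and uv: "covers U u v"
  obtain x where x: "(c, x) \<in> V" "g x = u"
    using condensation_aboveE[OF lo(1,3) condensations(2) c u] .
  have "(g x, v) \<in> U"
    using uv x(2) by (simp add: covers_def)
  then obtain y where y: "(x, y) \<in> V" "g y = v"
    by (rule condensation_aboveE[OF lo(1,3) condensations(2) FieldI2[OF x(1)]])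
  have "covers W (f x) (f y)"
    using covers_iff[OF x(1) lo_trans[OF lo(1) x(1) y(1)]] uv x(2) y(2) by simp
  then show False
    using dense condensation_mono[OF condensations(1) x(1)] by (simp add: dense_above_def)
qed

end

definition fixes_above :: "'a rel \<Rightarrow> 'a \<Rightarrow> ('a \<Rightarrow> 'a) \<Rightarrow> bool" where
  "fixes_above V c f \<longleftrightarrow> (\<forall>x. (c, x) \<in> V \<longrightarrow> f x = x)"

definition fixes_below :: "'a rel \<Rightarrow> 'a \<Rightarrow> ('a \<Rightarrow> 'a) \<Rightarrow> bool" where
  "fixes_below V c f \<longleftrightarrow> (\<forall>x. (x, c) \<in> V \<longrightarrow> f x = x)"

lemma fixes_below_downward:
  "lo V \<Longrightarrow> (c, z) \<in> V \<Longrightarrow> fixes_below V z f \<Longrightarrow> fixes_below V c f"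
  using lo_trans unfolding fixes_below_def by metis

lemma fixes_below_comp:
  assumes V: "lo V" and q: "condensation V W q" "fixes_below V c q" and h: "fixes_below W c h"
  shows "fixes_below V c (h \<circ> q)"
  unfolding fixes_below_def
proof (intro allI impI)
  fix x
  assume x: "(x, c) \<in> V"
  then have "q x = x" "q c = c"
    using q(2) lo_refl[OF V FieldI2[OF x]] by (simp_all add: fixes_below_def)
  then show "(h \<circ> q) x = x"
    using h condensation_mono[OF q(1) x] by (simp add: fixes_below_def)
qed

lemma condensation_fixing_above:
  assumes V: "lo V" and W: "lo W" and h: "condensation V W h"
    and above: "fixes_above V c h" and e: "(c, e) \<in> V"
  shows "(c, e) \<in> W" and "covering_chain W j e \<longleftrightarrow> covering_chain V j e"
    and "dense_above V e \<Longrightarrow> dense_above W e"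
proof -
  have h_c: "h c = c" and h_e: "h e = e"
    using above e lo_refl[OF V FieldI1[OF e]] by (simp_all add: fixes_above_def)
  then show "(c, e) \<in> W"
    using condensation_mono[OF h e] by simp
  have "h x = x" if "(e, x) \<in> V" for x
    using above lo_trans[OF V e that] by (simp add: fixes_above_def)
  then interpret equal_kernels_above V V W id h e
    using V W h condensation_id by unfold_locales simp_all
  show "covering_chain W j e \<longleftrightarrow> covering_chain V j e"
    using covering_chain_iff[OF lo_refl[OF V FieldI2[OF e]]] h_e by simp
  show "dense_above W e" if "dense_above V e"
    using dense_above_imp[OF _ FieldI2[OF e]] that h_e by simp
qed

abbreviation And :: "'c fm \<Rightarrow> 'c fm \<Rightarrow> 'c fm" where
  "And \<phi> \<psi> \<equiv> Neg (Imp \<phi> (Neg \<psi>))"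

definition covers_fm :: "'c trm \<Rightarrow> 'c trm \<Rightarrow> nat \<Rightarrow> 'c fm" where
  "covers_fm s u n = And (Le s u) (And (Neg (Eq s u))
     (All n (Imp (Le s (Var n)) (Imp (Le (Var n) u)
       (Imp (Neg (Eq (Var n) s)) (Eq (Var n) u))))))"

primrec covering_chain_fm :: "nat \<Rightarrow> 'c trm \<Rightarrow> nat \<Rightarrow> 'c fm" where
  "covering_chain_fm 0 s n = Neg Fls"
| "covering_chain_fm (Suc j) s n =
     Ex n (And (covers_fm s (Var n) (Suc n)) (covering_chain_fm j (Var n) (Suc n)))"

definition dense_above_fm :: "'c \<Rightarrow> 'c fm" where
  "dense_above_fm c = And
     (Ex 0 (And (Le (Const c) (Var 0)) (Neg (Eq (Const c) (Var 0)))))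
     (All 0 (All 1 (Imp (Le (Const c) (Var 0)) (Neg (covers_fm (Var 0) (Var 1) 2)))))"

lemma tval_upd: "n \<notin> tfv s \<Longrightarrow> tval \<iota> (\<nu>(n := x)) s = tval \<iota> \<nu> s"
  by (cases s) auto

lemma sat_covers_fm:
  assumes "n \<notin> tfv s" "n \<notin> tfv u"
  shows "sat V \<iota> \<nu> (covers_fm s u n) \<longleftrightarrow> covers V (tval \<iota> \<nu> s) (tval \<iota> \<nu> u)"
  using assms by (auto simp: covers_fm_def covers_def tval_upd Field_def)

lemma sat_covering_chain_fm:
  assumes "tfv s \<subseteq> {..<n}"
  shows "sat V \<iota> \<nu> (covering_chain_fm j s n) \<longleftrightarrow> covering_chain V j (tval \<iota> \<nu> s)"
  using assms
proof (induction j arbitrary: s n \<nu>)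
  case (Suc j)
  have "sat V \<iota> (\<nu>(n := x)) (covering_chain_fm j (Var n) (Suc n)) \<longleftrightarrow> covering_chain V j x" for x
    using Suc.IH[of "Var n" "Suc n"] by simp
  moreover have "n \<notin> tfv s" "Suc n \<notin> tfv s"
    using Suc.prems by auto
  then have "sat V \<iota> (\<nu>(n := x)) (covers_fm s (Var n) (Suc n)) \<longleftrightarrow> covers V (tval \<iota> \<nu> s) x" for x
    by (simp add: sat_covers_fm tval_upd)
  moreover have "y \<in> Field V" if "covers V x y" for x y
    using that by (auto simp: covers_def Field_def)
  ultimately show ?case
    by auto
qed simp

lemma covering_chain_fm_lang:
  "fv (covering_chain_fm j s n) \<subseteq> tfv s \<and> set_fm (covering_chain_fm j s n) \<subseteq> set_trm s"
  by (induction j arbitrary: s n) (fastforce simp: covers_fm_def)+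

lemma dense_above_fm_lang: "fv (dense_above_fm c) = {}" "set_fm (dense_above_fm c) = {c}"
  by (auto simp: dense_above_fm_def covers_fm_def)

lemma sat_dense_above_fm: "sat V \<iota> \<nu> (dense_above_fm c) \<longleftrightarrow> dense_above V (\<iota> c)"
proof -
  have "sat V \<iota> \<nu> (dense_above_fm c) \<longleftrightarrow> (\<exists>y\<in>Field V. (\<iota> c, y) \<in> V \<and> \<iota> c \<noteq> y) \<and>
      (\<forall>x\<in>Field V. \<forall>y\<in>Field V. (\<iota> c, x) \<in> V \<longrightarrow> \<not> covers V x y)"
    by (simp add: dense_above_fm_def sat_covers_fm)
  also have "\<dots> \<longleftrightarrow> dense_above V (\<iota> c)"
    by (auto simp: dense_above_def covers_def dest: FieldI1 FieldI2)
  finally show ?thesis .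
qed

lemma sat_Dia_dense_above_fm:
  "sat V \<iota> \<nu> (Dia (dense_above_fm c)) \<longleftrightarrow> possibly_dense_above V (\<iota> c)"
  unfolding sat_Dia possibly_dense_above_def by (simp add: sat_dense_above_fm)

lemma possibly_dense_aboveI:
  fixes W :: "'b rel"
  assumes "lo V" "c \<in> Field V" "lo W" "condensation V W f" "dense_above W (f c)"
  shows "possibly_dense_above V c"
  using sat_Dia_any[of V "dense_above_fm ()" "\<lambda>_. c" _ W f] assms
  by (simp add: dense_above_fm_lang sat_dense_above_fm sat_Dia_dense_above_fm del: sat.simps)

lemma possibly_dense_above_upstream:
  fixes V W :: "'a rel"
  assumes f: "condensation V W f" and possible: "possibly_dense_above W (f c)"
  shows "possibly_dense_above V c"
proof -
  obtain U :: "'a rel" and g where "lo U" "condensation W U g" "dense_above U ((g \<circ> f) c)"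
    using possible by (auto simp: possibly_dense_above_def)
  then show ?thesis
    unfolding possibly_dense_above_def using condensation_comp[OF f] by blast
qed

lemma possibly_dense_above_downward:
  assumes V: "lo V" and e: "(c, e) \<in> V" "dense_above V e"
  shows "possibly_dense_above V c"
proof -
  define A where "A = {x. (x, e) \<in> V}"
  have "e \<in> A"
    using lo_refl[OF V FieldI2[OF e(1)]] by (simp add: A_def)
  have "order_convex V A"
    using lo_trans[OF V] unfolding order_convex_def A_def by blast
  then obtain W where W: "lo W" "condensation V W (collapse A e)"
    using \<open>e \<in> A\<close> by (rule ex_condensation_collapse[OF V])
  have "fixes_above V e (collapse A e)"
    using lo_antisym[OF V] by (auto simp: fixes_above_def A_def intro!: collapse_fixes)
  then have "dense_above W e"
    using lo_refl[OF V FieldI2[OF e(1)]] e(2) by (rule condensation_fixing_above(3)[OF V W])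
  moreover have "collapse A e c = e"
    using e(1) by (simp add: collapse_def A_def)
  ultimately show ?thesis
    using W unfolding possibly_dense_above_def by metis
qed

lemma convex_fibres_if_fixes_below:
  assumes V: "lo V" and c: "c \<in> Field V" and U: "lo U" and f: "condensation V U f"
    and p_below: "fixes_below V c p" and p_above: "\<And>x. (c, x) \<in> V \<Longrightarrow> p x = s (f x)"
    and f_p: "\<And>x. x \<in> Field V \<Longrightarrow> f (p x) = f x"
    and le: "(x, y) \<in> V" "(y, z) \<in> V" and p_eq: "p x = p z"
  shows "p y = p x"
proof -
  have f_eq: "f x = f z"
    using f_p FieldI1[OF le(1)] FieldI2[OF le(2)] p_eq by metis
  have fixes_p: "p x = x" if "(x, c) \<in> V" for x
    using p_below that by (simp add: fixes_below_def)
  have above: "p y = p x" if "(c, x) \<in> V"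
    using p_above[OF that] p_above[OF lo_trans[OF V that le(1)]]
      condensation_convex_fibre[OF U f le f_eq] by simp
  consider (above) "(c, x) \<in> V" | (below) "(x, c) \<in> V" "(z, c) \<in> V"
    | (around) "(x, c) \<in> V" "(c, z) \<in> V"
    using lo_total[OF V c] FieldI1[OF le(1)] FieldI2[OF le(2)] by blast
  then show ?thesis
  proof cases
    case below
    then show ?thesis
      using le p_eq fixes_p lo_antisym[OF V] by metis
  next
    case around
    then have "x = s (f c)"
      using condensation_convex_fibre[OF U f around f_eq] f_eq p_eq p_above fixes_p by metis
    then have "x = c"
      using p_above fixes_p lo_refl[OF V c] by metis
    then show ?thesis
      using above lo_refl[OF V c] by simp
  qed (rule above)
qed

text \<open>A section of \<open>f\<close> allows one to collapse the part above \<open>c\<close> only.\<close>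

lemma condensation_fixing_below:
  fixes V :: "'a rel"
  assumes V: "lo V" and c: "c \<in> Field V" and U: "lo U" and f: "condensation V U f"
  obtains W :: "'a rel" and p
  where "lo W" "condensation V W p" "fixes_below V c p"
    "\<And>x y. (c, x) \<in> V \<Longrightarrow> (c, y) \<in> V \<Longrightarrow> p x = p y \<longleftrightarrow> f x = f y"
proof -
  define s where "s = (inv_into (Field V) f)(f c := c)"
  define p where "p x = (if (x, c) \<in> V then x else s (f x))" for x
  have p_below: "fixes_below V c p"
    by (simp add: fixes_below_def p_def)
  have p_above: "p x = s (f x)" if "(c, x) \<in> V" for x
    using that lo_antisym[OF V, of x c] by (auto simp: p_def s_def)
  have f_p: "f (p x) = f x" if "x \<in> Field V" for x
    using that by (simp add: p_def s_def f_inv_into_f)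
  have "p y = p x" if "(x, y) \<in> V" "(y, z) \<in> V" "p x = p z" for x y z
    using V c U f p_below p_above f_p that by (rule convex_fibres_if_fixes_below)
  then obtain W where "lo W" "condensation V W p"
    using ex_condensation_if_convex_fibres[OF V] by blast
  moreover have "p x = p y \<longleftrightarrow> f x = f y" if "(c, x) \<in> V" "(c, y) \<in> V" for x y
    using that p_above f_p FieldI2 by metis
  ultimately show thesis
    using that p_below by blast
qed

lemma possibly_dense_above_fixing_below:
  fixes V :: "'a rel"
  assumes V: "lo V" and c: "c \<in> Field V" and possible: "possibly_dense_above V c"
  obtains W :: "'a rel" and p
  where "lo W" "condensation V W p" "fixes_below V c p" "dense_above W c"
proof -
  obtain U :: "'a rel" and f where U: "lo U" "condensation V U f" "dense_above U (f c)"
    using possible unfolding possibly_dense_above_def by blast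
  obtain W :: "'a rel" and p where W: "lo W" "condensation V W p"
    and p: "fixes_below V c p"
    and kernel: "\<And>x y. (c, x) \<in> V \<Longrightarrow> (c, y) \<in> V \<Longrightarrow> p x = p y \<longleftrightarrow> f x = f y"
    using condensation_fixing_below[OF V c U(1,2)] by blast
  interpret equal_kernels_above V U W f p c
    by (rule equal_kernels_above.intro[OF V U(1) W(1) U(2) W(2)]) (simp add: kernel)
  have "dense_above W c"
    using dense_above_imp[OF U(3) c] p lo_refl[OF V c] by (simp add: fixes_below_def)
  then show thesis
    by (rule that[OF W p])
qed

subsection \<open>Buttons and a dial\<close>

lemma ex_condensation_cover:
  fixes V :: "'a rel"
  assumes V: "lo V" and cz: "(c, z) \<in> V" "c \<noteq> z"
  obtains W h where "lo W" "condensation V W h"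
    "fixes_below V c h" "fixes_above V z h" "\<And>u. covers W c u \<longleftrightarrow> u = z"
proof -
  define A where "A = {x. (c, x) \<in> V \<and> (x, z) \<in> V \<and> x \<noteq> z}"
  let ?h = "collapse A c"
  have c: "c \<in> A"
    using cz lo_refl[OF V FieldI1[OF cz(1)]] by (simp add: A_def)
  have "order_convex V A"
    using lo_trans[OF V] lo_antisym[OF V] unfolding order_convex_def A_def by blast
  then obtain W where W: "lo W" "condensation V W ?h"
    using c by (rule ex_condensation_collapse[OF V])
  have "fixes_below V c ?h" "fixes_above V z ?h"
    using lo_antisym[OF V]
    by (auto simp: fixes_below_def fixes_above_def A_def intro!: collapse_fixes)
  moreover have z: "?h z = z" and hc: "?h c = c"
    using c by (auto simp: collapse_def A_def)
  have "covers W (?h c) (?h z)"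
    unfolding covers_condensation_iff[OF V W FieldI1[OF cz(1)] FieldI2[OF cz(1)]]
    using z hc cz by (auto simp: collapse_def A_def)
  then have "covers W c u \<longleftrightarrow> u = z" for u
    using covers_unique[OF W(1)] z hc by metis
  ultimately show thesis
    using that[OF W] by blast
qed

lemma dense_aboveE:
  assumes V: "lo V" and dense: "dense_above V c"
  obtains z where "(c, z) \<in> V" "c \<noteq> z" "dense_above V z"
proof -
  obtain y where y: "(c, y) \<in> V" "c \<noteq> y"
    using dense by (auto simp: dense_above_def)
  then have "\<not> covers V c y"
    using dense lo_refl[OF V FieldI1[OF y(1)]] by (simp add: dense_above_def)
  then obtain z where z: "(c, z) \<in> V" "(z, y) \<in> V" "z \<noteq> c" "z \<noteq> y"
    using y by (auto simp: covers_def)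
  then have "dense_above V z"
    using dense lo_trans[OF V z(1)] unfolding dense_above_def by blast
  then show thesis
    using that z by blast
qed

lemma ex_condensation_dial:
  fixes V :: "'a rel"
  assumes V: "lo V" and "dense_above V c"
  shows "\<exists>(W :: 'a rel) q e. lo W \<and> condensation V W q \<and> fixes_below V c q \<and>
    (\<forall>j. covering_chain W j c \<longleftrightarrow> j \<le> m) \<and> (c, e) \<in> W \<and> dense_above W e"
  using assms(2)
proof (induction m arbitrary: c)
  case 0
  then have "(c, c) \<in> V" "covering_chain V j c \<longleftrightarrow> j \<le> 0" "fixes_below V c id" for j
    using lo_refl[OF V dense_above_Field] covering_chain_if_dense_above[OF V]
    by (simp_all add: fixes_below_def)
  then show ?case
    using V condensation_id 0 by blast
next
  case (Suc m)
  obtain z where z: "(c, z) \<in> V" "c \<noteq> z" "dense_above V z"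
    using dense_aboveE[OF V Suc.prems] .
  obtain W :: "'a rel" and q e where W: "lo W" "condensation V W q"
    and q: "fixes_below V z q" and chain: "\<And>j. covering_chain W j z \<longleftrightarrow> j \<le> m"
    and e: "(z, e) \<in> W" "dense_above W e"
    using Suc.IH[OF z(3)] by blast
  have "q c = c" "q z = z"
    using q z(1) lo_refl[OF V FieldI2[OF z(1)]] by (simp_all add: fixes_below_def)
  then have "(c, z) \<in> W"
    using condensation_mono[OF W(2) z(1)] by simp
  then obtain U h where U: "lo U" "condensation W U h"
    and h: "fixes_below W c h" "fixes_above W z h" and cover: "\<And>u. covers U c u \<longleftrightarrow> u = z"
    using ex_condensation_cover[OF W(1) _ z(2)] by blast
  note fixing_above = condensation_fixing_above[OF W(1) U h(2)]
  have "(c, z) \<in> U"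
    using cover by (auto simp: covers_def)
  then have "(c, e) \<in> U"
    using lo_trans[OF U(1) _ fixing_above(1)[OF e(1)]] by blast
  moreover have "covering_chain U j z \<longleftrightarrow> j \<le> m" for j
    using fixing_above(2)[OF lo_refl[OF W(1) FieldI1[OF e(1)]]] chain by simp
  then have "covering_chain U j c \<longleftrightarrow> j \<le> Suc m" for j
    using cover by (cases j) auto
  moreover have "fixes_below V c (h \<circ> q)"
    using fixes_below_comp[OF V W(2) fixes_below_downward[OF V z(1) q] h(1)] .
  ultimately show ?case
    using U(1) condensation_comp[OF W(2) U(2)] fixing_above(3)[OF e] by blast
qed

lemma ex_condensation_dial_if_possibly_dense_above:
  fixes V :: "'a rel"
  assumes V: "lo V" and c: "c \<in> Field V" and possible: "possibly_dense_above V c"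
  obtains W :: "'a rel" and q e where "lo W" "condensation V W q" "fixes_below V c q"
    "\<And>j. covering_chain W j c \<longleftrightarrow> j \<le> m" "(c, e) \<in> W" "dense_above W e"
proof -
  obtain U :: "'a rel" and p where U: "lo U" "condensation V U p"
    and p: "fixes_below V c p" and dense: "dense_above U c"
    using possibly_dense_above_fixing_below[OF V c possible] .
  obtain W :: "'a rel" and q e where W: "lo W" "condensation U W q"
    and q: "fixes_below U c q"
    and "\<And>j. covering_chain W j c \<longleftrightarrow> j \<le> m" "(c, e) \<in> W" "dense_above W e"
    using ex_condensation_dial[OF U(1) dense] by metis
  then show thesis
    using that condensation_comp[OF U(2) W(2)] fixes_below_comp[OF V U(2) p q] by blast
qed

lemma eq_if_mono_in_interval:
  assumes V: "lo V" and mono: "monotone_on {..N} (\<le>) (\<lambda>x y. (x, y) \<in> V) b"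
    and "j \<noteq> i" "j < N" "i < N"
    and j: "(b i, b j) \<in> V" and Suc_j: "(b (Suc j), b (Suc i)) \<in> V"
  shows "b j = b (Suc j)"
proof -
  have b: "(b k, b l) \<in> V" if "k \<le> l" "l \<le> N" for k l
    using monotone_onD[OF mono, of k l] that by simp
  have "(b (Suc j), b j) \<in> V"
  proof (cases "j < i")
    case True
    then show ?thesis
      using lo_trans[OF V b[of "Suc j" i] j] \<open>i < N\<close> by simp
  next
    case False
    then show ?thesis
      using lo_trans[OF V Suc_j b[of "Suc i" j]] \<open>j \<noteq> i\<close> \<open>j < N\<close> by simp
  qed
  then show ?thesis
    using lo_antisym[OF V b[of j "Suc j"]] \<open>j < N\<close> by simp
qed

lemma ex_condensation_press:
  fixes V :: "'a rel" and b :: "nat \<Rightarrow> 'a"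
  assumes V: "lo V" and mono: "monotone_on {..N} (\<le>) (\<lambda>x y. (x, y) \<in> V) b" and i: "i < N"
  obtains W :: "'a rel" and h where "lo W" "condensation V W h" "fixes_above V (b N) h"
    "\<And>j. j < N \<Longrightarrow> h (b j) = h (b (Suc j)) \<longleftrightarrow> j = i \<or> b j = b (Suc j)"
proof -
  have b: "(b j, b k) \<in> V" if "j \<le> k" "k \<le> N" for j k
    using monotone_onD[OF mono, of j k] that by simp
  define A where "A = {x. (b i, x) \<in> V \<and> (x, b (Suc i)) \<in> V}"
  let ?h = "collapse A (b (Suc i))"
  have A: "order_convex V A" "b (Suc i) \<in> A" "b i \<in> A"
    using lo_trans[OF V] b i unfolding order_convex_def A_def by auto
  obtain W where W: "lo W" "condensation V W ?h"
    using ex_condensation_collapse[OF V A(1,2)] .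
  have button: "?h (b j) = ?h (b (Suc j)) \<longleftrightarrow> j = i \<or> b j = b (Suc j)" if "j < N" for j
  proof -
    have "b j = b (Suc j)" if "j \<noteq> i" "b j \<in> A" "b (Suc j) \<in> A"
      using eq_if_mono_in_interval[OF V mono that(1) \<open>j < N\<close> i] that(2,3) by (simp add: A_def)
    then show ?thesis
      using A collapse_eq_iff[OF A(2)] by auto
  qed
  have "?h x = x" if "(b N, x) \<in> V" for x
    using lo_antisym[OF V _ lo_trans[OF V b[of "Suc i" N] that]] i
    by (intro collapse_fixes) (simp add: A_def)
  then have "fixes_above V (b N) ?h"
    by (simp add: fixes_above_def)
  then show thesis
    using that[OF W] button by blast
qed

lemma ex_condensation_press_and_dial:
  fixes V :: "'a rel" and b :: "nat \<Rightarrow> 'a"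
  assumes V: "lo V" and mono: "monotone_on {..N} (\<le>) (\<lambda>x y. (x, y) \<in> V) b"
    and possible: "possibly_dense_above V (b N)" and i: "i < N"
  shows "\<exists>(W :: 'a rel) g. lo W \<and> condensation V W g \<and>
    (\<forall>j<N. g (b j) = g (b (Suc j)) \<longleftrightarrow> j = i \<or> b j = b (Suc j)) \<and>
    (\<forall>j. covering_chain W j (g (b N)) \<longleftrightarrow> j \<le> m) \<and> possibly_dense_above W (g (b N))"
proof -
  have b: "(b j, b N) \<in> V" if "j \<le> N" for j
    using monotone_onD[OF mono, of j N] that by simp
  obtain U :: "'a rel" and q e where U: "lo U" "condensation V U q"
    and q: "fixes_below V (b N) q" and dial: "\<And>j. covering_chain U j (b N) \<longleftrightarrow> j \<le> m"
    and e: "(b N, e) \<in> U" "dense_above U e"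
    using ex_condensation_dial_if_possibly_dense_above[where m = m,
        OF V FieldI1[OF b[OF order.refl]] possible] by blast
  have q_b: "q (b j) = b j" if "j \<le> N" for j
    using q b[OF that] by (simp add: fixes_below_def)
  then have "monotone_on {..N} (\<le>) (\<lambda>x y. (x, y) \<in> U) b"
    using mono condensation_mono[OF U(2)] unfolding monotone_on_def by (metis atMost_iff)
  then obtain W :: "'a rel" and h where W: "lo W" "condensation U W h"
    and h: "fixes_above U (b N) h"
    and button: "\<And>j. j < N \<Longrightarrow> h (b j) = h (b (Suc j)) \<longleftrightarrow> j = i \<or> b j = b (Suc j)"
    using ex_condensation_press[OF U(1) _ i] by blast
  have top: "(b N, b N) \<in> U" "(h \<circ> q) (b N) = b N"
    using lo_refl[OF U(1) FieldI1[OF e(1)]] h q_b by (simp_all add: fixes_above_def)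
  note fixing_above = condensation_fixing_above[OF U(1) W h]
  have "(h \<circ> q) (b j) = (h \<circ> q) (b (Suc j)) \<longleftrightarrow> j = i \<or> b j = b (Suc j)" if "j < N" for j
    using button[OF that] q_b that by simp
  moreover have "covering_chain W j ((h \<circ> q) (b N)) \<longleftrightarrow> j \<le> m" for j
    unfolding top(2) using fixing_above(2)[OF top(1)] dial by simp
  moreover have "possibly_dense_above W ((h \<circ> q) (b N))"
    unfolding top(2) using W(1) fixing_above(1)[OF e(1)] fixing_above(3)[OF e]
    by (rule possibly_dense_above_downward)
  ultimately show ?thesis
    using W(1) condensation_comp[OF U(2) W(2)] by blast
qed

subsection \<open>Expressible properties\<close>

definition expressible :: "'a rel \<Rightarrow> ('a rel \<Rightarrow> ('a \<Rightarrow> 'a) \<Rightarrow> bool) \<Rightarrow> bool" where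
  "expressible L P \<longleftrightarrow> (\<exists>\<phi>\<in>lang L. \<forall>V f \<nu>. sat V f \<nu> \<phi> \<longleftrightarrow> P V f)"

lemma expressibleI:
  assumes "\<phi> \<in> lang L" "\<And>V f \<nu>. sat V f \<nu> \<phi> \<longleftrightarrow> P V f"
  shows "expressible L P"
  using assms unfolding expressible_def by blast

lemma expressible_const: "expressible L (\<lambda>V f. b)"
  by (rule expressibleI[of "if b then Neg Fls else Fls"]) (auto simp: lang_def)

lemma expressible_case_bool:
  assumes P: "expressible L P" and Q: "\<And>b. expressible L (Q b)"
  shows "expressible L (\<lambda>V f. Q (P V f) V f)"
proof -
  obtain \<phi> where \<phi>: "\<phi> \<in> lang L" "\<And>V f \<nu>. sat V f \<nu> \<phi> \<longleftrightarrow> P V f"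
    using P unfolding expressible_def by blast
  obtain \<psi> where \<psi>: "\<And>b. \<psi> b \<in> lang L" "\<And>b V f \<nu>. sat V f \<nu> (\<psi> b) \<longleftrightarrow> Q b V f"
    using Q unfolding expressible_def by metis
  show ?thesis
  proof (rule expressibleI)
    show "And (Imp \<phi> (\<psi> True)) (Imp (Neg \<phi>) (\<psi> False)) \<in> lang L"
      using \<phi>(1) \<psi>(1) by (simp add: lang_def)
    show "sat V f \<nu> (And (Imp \<phi> (\<psi> True)) (Imp (Neg \<phi>) (\<psi> False))) \<longleftrightarrow> Q (P V f) V f" for V f \<nu>
      by (cases "P V f") (simp_all add: \<phi>(2) \<psi>(2))
  qed
qed

lemma expressible_Collect:
  assumes "finite I" and P: "\<And>i. i \<in> I \<Longrightarrow> expressible L (P i)"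
    and Q: "\<And>S. expressible L (Q S)"
  shows "expressible L (\<lambda>V f. Q {i \<in> I. P i V f} V f)"
  using assms
proof (induction I arbitrary: Q rule: finite_induct)
  case empty
  then show ?case
    by simp
next
  case (insert i I)
  let ?Q = "\<lambda>b V f. Q (if b then insert i {j \<in> I. P j V f} else {j \<in> I. P j V f}) V f"
  have cases: "expressible L (?Q b)" for b
    using insert.IH[of "\<lambda>S. Q (if b then insert i S else S)"] insert.prems by simp
  have "expressible L (\<lambda>V f. ?Q (P i V f) V f)"
    by (rule expressible_case_bool[where Q = ?Q, OF insert.prems(1) cases]) simp
  moreover have "{j \<in> insert i I. P j V f} =
      (if P i V f then insert i {j \<in> I. P j V f} else {j \<in> I. P j V f})" for V f
    by auto
  ultimately show ?case
    by simp
qed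

lemma expressible_eq:
  assumes "c \<in> Field L" "d \<in> Field L"
  shows "expressible L (\<lambda>V f. f c = f d)"
  using assms by (intro expressibleI[of "Eq (Const c) (Const d)"]) (auto simp: lang_def)

lemma expressible_covering_chain:
  assumes "c \<in> Field L"
  shows "expressible L (\<lambda>V f. covering_chain V j (f c))"
  using covering_chain_fm_lang[of j "Const c" 0] assms
  by (intro expressibleI[of "covering_chain_fm j (Const c) 0"])
    (auto simp: lang_def sat_covering_chain_fm)

lemma expressible_possibly_dense_above:
  assumes "c \<in> Field L"
  shows "expressible L (\<lambda>V f. possibly_dense_above V (f c))"
  using assms
  by (intro expressibleI[of "Dia (dense_above_fm c)"] sat_Dia_dense_above_fm)
    (simp add: lang_def dense_above_fm_lang)

text \<open>A labelling is an expressible bounded morphism from the condensations of \<open>L\<close> to the frame.\<close>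

locale labelling =
  fixes L :: "'a rel" and F :: "'w set" and R :: "'w \<Rightarrow> 'w \<Rightarrow> bool" and r :: 'w
    and label :: "'a rel \<Rightarrow> ('a \<Rightarrow> 'a) \<Rightarrow> 'w"
  assumes lo: "lo L"
    and expressible: "\<And>Q. expressible L (\<lambda>V f. Q (label V f))"
    and label_root: "label L id = r"
    and label_in: "label V f \<in> F"
    and forth_condition: "condensation V W g \<Longrightarrow> R (label V f) (label W (g \<circ> f))"
    and back_condition: "lo V \<Longrightarrow> condensation L V f \<Longrightarrow> w \<in> F \<Longrightarrow> R (label V f) w \<Longrightarrow>
      \<exists>W g. lo W \<and> condensation V W g \<and> label W (g \<circ> f) = w"
begin

lemma sat_iff_forces:
  assumes \<sigma>: "\<And>p V f \<nu>. sat V f \<nu> (\<sigma> p) \<longleftrightarrow> v p (label V f)"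
    and "lo V" "condensation L V f"
  shows "sat V f \<nu> (inst \<sigma> \<phi>) \<longleftrightarrow> forces F R v (label V f) \<phi>"
  using assms(2,3)
proof (induction \<phi> arbitrary: V f \<nu>)
  case (PBox \<phi>)
  have IH: "sat W (g \<circ> f) (g \<circ> \<nu>) (inst \<sigma> \<phi>) \<longleftrightarrow> forces F R v (label W (g \<circ> f)) \<phi>"
    if "lo W" "condensation V W g" for W :: "'a rel" and g
    using PBox.IH that condensation_comp[OF PBox.prems(2)] by blast
  show ?case
  proof
    assume box: "sat V f \<nu> (inst \<sigma> (\<box>\<^sub>p \<phi>))"
    have "forces F R v w \<phi>" if w: "w \<in> F" "R (label V f) w" for w
    proof -
      obtain W g where "lo W" "condensation V W g" "label W (g \<circ> f) = w"
        using back_condition[OF PBox.prems w] by blast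
      then show ?thesis
        using IH[of W g] box by simp
    qed
    then show "forces F R v (label V f) (\<box>\<^sub>p \<phi>)"
      by simp
  next
    assume box: "forces F R v (label V f) (\<box>\<^sub>p \<phi>)"
    have "sat W (g \<circ> f) (g \<circ> \<nu>) (inst \<sigma> \<phi>)"
      if "lo W" "condensation V W g" for W :: "'a rel" and g
      using IH[OF that] forth_condition[OF that(2)] box label_in by simp
    then show "sat V f \<nu> (inst \<sigma> (\<box>\<^sub>p \<phi>))"
      by simp
  qed
qed (simp_all add: \<sigma>)

theorem refuted_not_valid:
  assumes "\<not> forces F R v r \<psi>"
  shows "\<psi> \<notin> Val L (lang L)"
proof
  assume valid: "\<psi> \<in> Val L (lang L)"
  have "\<exists>\<phi>\<in>lang L. \<forall>V f \<nu>. sat V f \<nu> \<phi> \<longleftrightarrow> v p (label V f)" for p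
    using expressible[of "v p"] unfolding expressible_def .
  then obtain \<sigma> where \<sigma>: "\<And>p. \<sigma> p \<in> lang L" "\<And>p V f \<nu>. sat V f \<nu> (\<sigma> p) \<longleftrightarrow> v p (label V f)"
    by metis
  obtain a where "a \<in> Field L"
    using lo by (auto simp: lo_def)
  then have "range (\<lambda>_. a) \<subseteq> Field L"
    by auto
  moreover have "range \<sigma> \<subseteq> lang L"
    using \<sigma>(1) by blast
  ultimately have "sat L id (\<lambda>_. a) (inst \<sigma> \<psi>)"
    using valid unfolding Val_def holds_def by blast
  then show False
    using sat_iff_forces[OF \<sigma>(2) lo condensation_id] label_root assms by simp
qed

end

subsection \<open>Labelling by buttons and a dial\<close>

text \<open>The set \<open>P\<close> of pressed buttons selects a cluster of the frame and the dial \<open>d\<close> a point in it.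
  Once the dial is no longer \<open>alive\<close>, or two incomparable buttons are pressed, the label is final.\<close>

context topped_frame
begin

definition greatest :: "'w set \<Rightarrow> 'w set" where
  "greatest P = {u \<in> F. (\<forall>v\<in>P. R v u) \<and> (\<exists>v\<in>P. R u v)}"

definition button_label :: "bool \<Rightarrow> 'w set \<Rightarrow> 'w \<Rightarrow> 'w" where
  "button_label alive P d =
     (if alive \<and> totalp_on (insert r P) R
      then if d \<in> greatest (insert r P) then d else (SOME u. u \<in> greatest (insert r P))
      else t)"

lemma greatest_nonempty:
  assumes "P \<subseteq> F" "P \<noteq> {}" "totalp_on P R"
  shows "greatest P \<noteq> {}"
proof -
  obtain u where u: "u \<in> P" "\<forall>v\<in>P. v \<noteq> u \<longrightarrow> R v u"
    using Finite_Set.bex_greatest_element[OF finite_subset[OF assms(1) finite] assms(2) _ assms(3)]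
      transp_on_subset[OF trans] by blast
  have "R u u"
    using u(1) assms(1) refl by (auto simp: reflp_on_def)
  then have "\<forall>v\<in>P. R v u"
    using u(2) by metis
  then have "u \<in> greatest P"
    using u(1) \<open>R u u\<close> assms(1) by (auto simp: greatest_def)
  then show ?thesis
    by blast
qed

lemma button_label_alive:
  assumes "P \<subseteq> F" "totalp_on (insert r P) R"
  shows "button_label True P d \<in> greatest (insert r P)"
  using greatest_nonempty[of "insert r P"] assms root_in
  by (auto simp: button_label_def some_in_eq)

lemma button_label_final:
  "\<not> (alive \<and> totalp_on (insert r P) R) \<Longrightarrow> button_label alive P d = t"
  by (auto simp: button_label_def)

lemma button_label_in:
  assumes "P \<subseteq> F"
  shows "button_label alive P d \<in> F"
proof (cases "alive \<and> totalp_on (insert r P) R")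
  case True
  then show ?thesis
    using button_label_alive[OF assms, of d] by (simp add: greatest_def)
next
  case False
  then show ?thesis
    using button_label_final top_in by simp
qed

lemma button_label_root: "button_label True {} r = r"
  using root_in refl by (simp add: button_label_def greatest_def totalp_on_def reflp_on_def)

lemma button_label_mono:
  assumes sub: "P \<subseteq> P'" "P' \<subseteq> F" and "alive' \<Longrightarrow> alive"
  shows "R (button_label alive P d) (button_label alive' P' d')"
proof (cases "alive' \<and> totalp_on (insert r P') R")
  case True
  have "totalp_on (insert r P) R"
    using True sub(1) by (auto intro: totalp_on_subset)
  then have "button_label True P d \<in> greatest (insert r P)"
    using button_label_alive sub by blast
  then obtain v where v: "v \<in> insert r P" "R (button_label True P d) v"
    by (auto simp: greatest_def)
  have "button_label True P' d' \<in> greatest (insert r P')"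
    using button_label_alive sub(2) True by blast
  then have "R v (button_label True P' d')"
    using v(1) sub(1) by (auto simp: greatest_def)
  then have "R (button_label True P d) (button_label True P' d')"
    using v(2) transpD[OF trans] by blast
  then show ?thesis
    using True assms(3) by simp
next
  case False
  then show ?thesis
    using button_label_final button_label_in[of P] below_top sub by auto
qed

lemma button_label_step:
  assumes P: "P \<subseteq> F" and total: "totalp_on (insert r P) R"
    and v: "v \<in> F" "R (button_label True P d) v"
  shows "button_label True (insert v P) v = v"
proof -
  have below: "R u v" if "u \<in> insert r P" for u
    using button_label_alive[OF P total, of d] that v(2) transpD[OF trans]
    unfolding greatest_def by blast
  have "R v v"
    using v(1) refl by (simp add: reflp_on_def)
  then have "totalp_on (insert r (insert v P)) R"
    using total below unfolding totalp_on_def by blast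
  moreover have "v \<in> greatest (insert r (insert v P))"
    using below \<open>R v v\<close> v(1) unfolding greatest_def by blast
  ultimately show ?thesis
    by (simp add: button_label_def)
qed

end

locale buttons_and_dial = topped_frame F R r t for F :: "'w set" and R r t +
  fixes L :: "'a rel" and a :: "nat \<Rightarrow> 'a" and N :: nat and h :: "nat \<Rightarrow> 'w"
  assumes lo: "lo L"
    and ascending: "(a j, a k) \<in> L \<longleftrightarrow> j \<le> k"
    and possible: "possibly_dense_above L (a N)"
    and h: "h ` {..<N} = F"
begin

definition pressed :: "('a \<Rightarrow> 'a) \<Rightarrow> nat set" where
  "pressed f = {i \<in> {..<N}. f (a i) = f (a (Suc i))}"

definition dial :: "'a rel \<Rightarrow> ('a \<Rightarrow> 'a) \<Rightarrow> nat" where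
  "dial V f = card {j \<in> {..<N}. covering_chain V (Suc j) (f (a N))}"

text \<open>Until a button is pressed the dial, whose initial value depends on \<open>L\<close>, is ignored.\<close>

definition label :: "'a rel \<Rightarrow> ('a \<Rightarrow> 'a) \<Rightarrow> 'w" where
  "label V f = button_label (possibly_dense_above V (f (a N))) (h ` pressed f)
     (if pressed f = {} then r else h (dial V f))"

lemma a_in_Field: "a j \<in> Field L"
  using ascending[of j j] by (auto intro: FieldI1)

lemma pressed_in: "h ` pressed f \<subseteq> F"
  using h by (auto simp: pressed_def)

lemma expressible_label: "expressible L (\<lambda>V f. Q (label V f))"
proof -
  let ?Q = "\<lambda>S D b. Q (button_label b (h ` S) (if S = {} then r else h (card D)))"
  have expressible_alive: "expressible L (\<lambda>V f. ?Q S D (possibly_dense_above V (f (a N))))" for S D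
    by (rule expressible_case_bool[OF expressible_possibly_dense_above expressible_const])
      (rule a_in_Field)
  have expressible_dial: "expressible L (\<lambda>V f. ?Q S {j \<in> {..<N}. covering_chain V (Suc j) (f (a N))}
      (possibly_dense_above V (f (a N))))" for S
    by (rule expressible_Collect[OF finite_lessThan expressible_covering_chain expressible_alive])
      (rule a_in_Field)
  have "expressible L (\<lambda>V f. ?Q {i \<in> {..<N}. f (a i) = f (a (Suc i))}
      {j \<in> {..<N}. covering_chain V (Suc j) (f (a N))} (possibly_dense_above V (f (a N))))"
    by (rule expressible_Collect[OF finite_lessThan expressible_eq expressible_dial]) (rule a_in_Field)+
  then show ?thesis
    unfolding label_def dial_def pressed_def .
qed

lemma label_root: "label L id = r"
proof -
  have "a i \<noteq> a (Suc i)" for i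
    using ascending[of "Suc i" i] ascending[of i i] by auto
  then have "pressed id = {}"
    by (simp add: pressed_def)
  then show ?thesis
    using possible button_label_root by (simp add: label_def)
qed

lemma label_forth:
  assumes "condensation V W g"
  shows "R (label V f) (label W (g \<circ> f))"
  unfolding label_def
proof (rule button_label_mono)
  show "h ` pressed f \<subseteq> h ` pressed (g \<circ> f)"
    by (auto simp: pressed_def)
  show "possibly_dense_above V (f (a N))" if "possibly_dense_above W ((g \<circ> f) (a N))"
    using possibly_dense_above_upstream[OF assms] that by simp
qed (rule pressed_in)

lemma label_back:
  assumes V: "lo V" and f: "condensation L V f" and w: "w \<in> F" "R (label V f) w"
  shows "\<exists>W g. lo W \<and> condensation V W g \<and> label W (g \<circ> f) = w"
proof (cases "possibly_dense_above V (f (a N)) \<and> totalp_on (insert r (h ` pressed f)) R")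
  case True
  obtain i where i: "i < N" "h i = w"
    using w(1) unfolding h[symmetric] by auto
  have monotone: "monotone_on {..N} (\<le>) (\<lambda>x y. (x, y) \<in> V) (\<lambda>j. f (a j))"
    using condensation_mono[OF f] ascending by (simp add: monotone_on_def)
  obtain W :: "'a rel" and g where W: "lo W" "condensation V W g"
    and button: "\<And>j. j < N \<Longrightarrow>
      g (f (a j)) = g (f (a (Suc j))) \<longleftrightarrow> j = i \<or> f (a j) = f (a (Suc j))"
    and chain: "\<And>j. covering_chain W j (g (f (a N))) \<longleftrightarrow> j \<le> i"
    and alive: "possibly_dense_above W (g (f (a N)))"
    using ex_condensation_press_and_dial[where b = "\<lambda>j. f (a j)" and m = i,
        OF V monotone conjunct1[OF True] i(1)] by blast
  have pressed: "pressed (g \<circ> f) = insert i (pressed f)"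
    using button i(1) by (auto simp: pressed_def)
  have "{j \<in> {..<N}. covering_chain W (Suc j) ((g \<circ> f) (a N))} = {..<i}"
    using i(1) by (auto simp del: covering_chain.simps simp: chain)
  then have "dial W (g \<circ> f) = i"
    by (simp add: dial_def del: covering_chain.simps)
  then have "label W (g \<circ> f) = button_label True (insert w (h ` pressed f)) w"
    using alive i(2) by (simp add: label_def pressed)
  also have "\<dots> = w"
    using button_label_step[OF pressed_in _ w(1)] w(2) True unfolding label_def by simp
  finally show ?thesis
    using W by blast
next
  case False
  then have "label V f = t"
    unfolding label_def by (rule button_label_final)
  then have "label V (id \<circ> f) = w"
    using w(2) top_final[of w] by simp
  then show ?thesis
    using V condensation_id by blast
qed

sublocale labelling L F R r label
  using lo expressible_label label_root label_forth label_back button_label_in[OF pressed_in]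
  by unfold_locales (simp_all add: label_def)

end

subsection \<open>Non-scattered orders\<close>

definition le_on :: "'b::ord set \<Rightarrow> 'b rel" where
  "le_on A = {(x, y). x \<in> A \<and> y \<in> A \<and> x \<le> y}"

lemma Field_le_on: "Field (le_on A) = A" for A :: "'b::preorder set"
  by (auto simp: le_on_def Field_def)

lemma lo_le_on: "A \<noteq> {} \<Longrightarrow> lo (le_on A)" for A :: "'b::linorder set"
  unfolding lo_def order_on_defs Field_le_on
  by (auto simp: le_on_def refl_on_def trans_def antisym_def total_on_def)

lemma dense_above_le_on:
  fixes A :: "'b::linorder set"
  assumes c: "c \<in> A" "y \<in> A" "c < y"
    and dense: "\<And>x y. x \<in> A \<Longrightarrow> y \<in> A \<Longrightarrow> x < y \<Longrightarrow> \<exists>z\<in>A. x < z \<and> z < y"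
  shows "dense_above (le_on A) c"
  unfolding dense_above_def
proof (intro conjI allI impI notI)
  show "\<exists>y. (c, y) \<in> le_on A \<and> c \<noteq> y"
    using c by (auto simp: le_on_def less_le)
  fix u v
  assume covers: "covers (le_on A) u v"
  then have "u \<in> A" "v \<in> A" "u < v"
    by (auto simp: covers_def le_on_def)
  then obtain z where "z \<in> A" "u < z" "z < v"
    using dense by blast
  then show False
    using covers by (auto simp: covers_def le_on_def)
qed

lemma ex_condensation_into_reals:
  fixes e :: "rat \<Rightarrow> 'a"
  assumes L: "lo L" and e: "\<And>x y. (e x, e y) \<in> L \<longleftrightarrow> x \<le> y" and "p \<le> q"
  obtains f :: "'a \<Rightarrow> real" where "condensation L (le_on (f ` Field L)) f"
    "\<And>s. s \<in> {p..q} \<Longrightarrow> f (e s) = of_rat s" "\<And>x. f x \<in> {of_rat p..of_rat q}"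
proof -
  define S where "S x = insert p {s \<in> {p..q}. (e s, x) \<in> L}" for x
  define f :: "'a \<Rightarrow> real" where "f x = Sup (of_rat ` S x)" for x
  have S: "p \<in> S x" "\<And>s. s \<in> S x \<Longrightarrow> p \<le> s \<and> s \<le> q" for x
    using \<open>p \<le> q\<close> by (auto simp: S_def)
  then have bounded: "bdd_above (of_rat ` S x :: real set)" for x
    by (intro bdd_aboveI[of _ "of_rat q"]) (auto simp: of_rat_less_eq)
  have "f x \<le> f y" if "(x, y) \<in> L" for x y
    unfolding f_def using bounded lo_trans[OF L _ that] S(1)
    by (intro cSup_subset_mono) (auto simp: S_def)
  then have "condensation L (le_on (f ` Field L)) f"
    unfolding condensation_def Field_le_on by (auto simp: le_on_def intro: FieldI1 FieldI2)
  moreover have "f (e s) = of_rat s" if "s \<in> {p..q}" for s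
    unfolding f_def using that by (intro cSup_eq_maximum) (auto simp: S_def e of_rat_less_eq)
  moreover have "of_rat p \<le> f x" "f x \<le> of_rat q" for x
    unfolding f_def using S(1)[of x] S(2)[of _ x] bounded[of x]
    by (auto intro!: cSup_upper cSup_least simp: of_rat_less_eq)
  ultimately show thesis
    by (intro that[of f]) simp_all
qed

lemma possibly_dense_above_rat_embedding:
  fixes e :: "rat \<Rightarrow> 'a"
  assumes L: "lo L" and e: "\<And>x y. (e x, e y) \<in> L \<longleftrightarrow> x \<le> y"
  shows "possibly_dense_above L (e s)"
proof -
  have "s \<le> s + 1"
    by simp
  then obtain f :: "'a \<Rightarrow> real" where f: "condensation L (le_on (f ` Field L)) f"
    and f_e: "\<And>q. q \<in> {s..s + 1} \<Longrightarrow> f (e q) = of_rat q"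
    and bounds: "\<And>x. f x \<in> {of_rat s..of_rat (s + 1)}"
    using ex_condensation_into_reals[OF L e] by metis
  have e_in_Field: "e q \<in> Field L" for q
    using FieldI1[of "e q" "e q" L] e by simp
  have rat_in_image: "of_rat q \<in> f ` Field L" if "q \<in> {s..s + 1}" for q
    using f_e[OF that] e_in_Field[of q] by (metis imageI)
  have "\<exists>w\<in>f ` Field L. u < w \<and> w < v"
    if uv: "u \<in> f ` Field L" "v \<in> f ` Field L" "u < v" for u v
  proof -
    obtain q where q: "u < of_rat q" "of_rat q < v"
      using of_rat_dense[OF uv(3)] by blast
    have "of_rat s \<le> u" "v \<le> of_rat (s + 1)"
      using uv(1,2) bounds by auto
    then have "(of_rat s :: real) \<le> of_rat q" "(of_rat q :: real) \<le> of_rat (s + 1)"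
      using q by linarith+
    then have "q \<in> {s..s + 1}"
      by (simp add: of_rat_less_eq)
    then show ?thesis
      using rat_in_image q by blast
  qed
  then have "dense_above (le_on (f ` Field L)) (f (e s))"
    using rat_in_image[of s] rat_in_image[of "s + 1"] f_e[of s]
    by (intro dense_above_le_on[of _ _ "of_rat (s + 1)"]) (simp_all add: of_rat_less)
  moreover have "lo (le_on (f ` Field L))"
    using L by (intro lo_le_on) (simp add: lo_def)
  ultimately show ?thesis
    using possibly_dense_aboveI[OF L e_in_Field] f by blast
qed

lemma ex_non_scattered:
  assumes "infinite (UNIV :: 'a set)"
  obtains L :: "'a rel" where "lo L" "\<not> scattered L"
proof -
  obtain k :: "nat \<Rightarrow> 'a" where "inj k"
    using infinite_countable_subset[OF assms] by blast
  then have inj: "inj (k \<circ> to_nat :: rat \<Rightarrow> 'a)"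
    by (intro inj_compose) auto
  let ?e = "k \<circ> to_nat :: rat \<Rightarrow> 'a"
  have "lo ((\<lambda>(x, y). (?e x, ?e y)) ` le_on UNIV)"
    using lo_transfer(1)[OF lo_le_on, of UNIV ?e] inj
    by (simp only: Field_le_on UNIV_not_empty simp_thms)
  moreover have "x \<le> y \<longleftrightarrow> (?e x, ?e y) \<in> (\<lambda>(x, y). (?e x, ?e y)) ` le_on UNIV" for x y
    using inj_eq[OF inj] by (auto simp: le_on_def image_iff)
  ultimately show thesis
    using that unfolding scattered_def by blast
qed

theorem refuted_not_valid_non_scattered:
  fixes L :: "'a rel"
  assumes L: "lo L" "\<not> scattered L"
    and frame: "topped_frame F R r t" and refuted: "\<not> forces F R v r \<psi>"
  shows "\<psi> \<notin> Val L (lang L)"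
proof -
  obtain e :: "rat \<Rightarrow> 'a" where e: "\<And>x y. (e x, e y) \<in> L \<longleftrightarrow> x \<le> y"
    using L(2) unfolding scattered_def by metis
  interpret topped_frame F R r t
    by (fact frame)
  obtain N and h :: "nat \<Rightarrow> _" where "F = h ` {i. i < N}"
    using finite unfolding finite_conv_nat_seg_image by blast
  then have "h ` {..<N} = F"
    by (simp add: lessThan_def)
  then interpret buttons_and_dial F R r t L "\<lambda>i. e (of_nat i)" N h
    by unfold_locales (simp_all add: L(1) e possibly_dense_above_rat_embedding)
  show ?thesis
    using refuted by (rule refuted_not_valid)
qed

theorem Val_non_scattered:
  assumes "lo L" "\<not> scattered L"
  shows "Val L (lang L) = S421"
proof
  show "Val L (lang L) \<subseteq> S421"
    using S421_complete refuted_not_valid_non_scattered[OF assms] by (metis subsetI)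
qed (rule S421_subset_Val[OF assms(1)])

theorem theorem8p4:
  fixes L :: "'a rel"
  shows "(lo L \<and> \<not> scattered L \<longrightarrow> Val L (lang L) = S421) \<and>
         (\<forall>W :: 'a rel. lo W \<longrightarrow> S421 \<subseteq> Val W (lang W)) \<and>
         (infinite (UNIV :: 'a set) \<longrightarrow>
            {\<psi>. \<forall>W :: 'a rel. lo W \<longrightarrow> \<psi> \<in> Val W (lang W)} = S421)"
proof (intro conjI impI allI)
  assume "infinite (UNIV :: 'a set)"
  then obtain M :: "'a rel" where "lo M" "Val M (lang M) = S421"
    using ex_non_scattered Val_non_scattered by metis
  then show "{\<psi>. \<forall>W :: 'a rel. lo W \<longrightarrow> \<psi> \<in> Val W (lang W)} = S421"
    using S421_subset_Val by blast
qed (auto simp: Val_non_scattered S421_subset_Val)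

end
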